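(* Let $n\ge 2$ and $N\ge 2$. Suppose that the estimate $d\le c(2,N)$ holds for the degree $d$ of every rational proper holomorphic mapping from $B_2$ to $B_N$. Then the estimate $$d\le \frac{c(2,N)}{2n-3}$$ holds for the degree $d$ of every rational proper holomorphic mapping from $B_n$ to $B_N$.
   Context: $B_n$ is the open unit ball in $\mathbb{C}^n$. A rational proper mapping $f:B_n\to B_N$ is a proper holomorphic map that can be written $f=p/q$ with $p:\mathbb{C}^n\to\mathbb{C}^N$ a polynomial map and $q$ a polynomial; its degree is the maximum of the degrees of $p$ and $q$ when $p/q$ is reduced to lowest terms. Here $c(2,N)$ is a number depending only on $N$. *)

theory Defs
  imports "HOL-Analysis.Analysis" "HOL-Library.Poly_Mapping"
begin

text \<open>
  Polynomials in the variables indexed by \<open>'n\<close>, as finitely supported maps from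
  exponent vectors to coefficients; the ring structure (and hence divisibility)
  on this type is the convolution product of \<open>Poly_Mapping\<close>.
\<close>

type_synonym 'n cpoly = "('n \<Rightarrow>\<^sub>0 nat) \<Rightarrow>\<^sub>0 complex"

definition cpoly_eval :: "'n::finite cpoly \<Rightarrow> complex ^ 'n \<Rightarrow> complex" where
  "cpoly_eval P z =
     (\<Sum>m\<in>Poly_Mapping.keys P. Poly_Mapping.lookup P m * (\<Prod>i\<in>UNIV. (z $ i) ^ Poly_Mapping.lookup m i))"

text \<open>Total degree; the zero polynomial gets degree 0.\<close>

definition cpoly_degree :: "'n::finite cpoly \<Rightarrow> nat" where
  "cpoly_degree P = Max (insert 0 ((\<lambda>m. \<Sum>i\<in>UNIV. Poly_Mapping.lookup m i) ` Poly_Mapping.keys P))"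

definition cpoly_map_eval :: "('n::finite cpoly) ^ 'm \<Rightarrow> complex ^ 'n \<Rightarrow> complex ^ 'm" where
  "cpoly_map_eval p z = (\<chi> j. cpoly_eval (p $ j) z)"

definition cpoly_map_degree :: "('n::finite cpoly) ^ 'm::finite \<Rightarrow> nat" where
  "cpoly_map_degree p = Max (range (\<lambda>j. cpoly_degree (p $ j)))"

text \<open>
  Holomorphy in several variables, for open \<open>S\<close>: the real Frechet derivative
  exists at every point and is complex linear (\<open>*s\<close> is multiplication by complex scalars).
\<close>

definition holomorphic_map_on :: "(complex ^ 'n \<Rightarrow> complex ^ 'm) \<Rightarrow> (complex ^ 'n) set \<Rightarrow> bool" where
  "holomorphic_map_on f S \<longleftrightarrow>
     (\<forall>z\<in>S. \<exists>D. (f has_derivative D) (at z) \<and> (\<forall>c v. D (c *s v) = c *s D v))"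

definition proper_holomorphic_ball_map :: "(complex ^ 'n::finite \<Rightarrow> complex ^ 'm::finite) \<Rightarrow> bool" where
  "proper_holomorphic_ball_map f \<longleftrightarrow>
     holomorphic_map_on f (ball 0 1) \<and>
     proper_map (top_of_set (ball 0 1)) (top_of_set (ball 0 1)) f"

text \<open>\<open>proper_map\<close> is defined by closedness and compact fibres; here it is equivalent to
  compactness of preimages of compact sets.\<close>

lemma proper_holomorphic_ball_map_iff:
  fixes f :: "complex ^ 'n::finite \<Rightarrow> complex ^ 'm::finite"
  shows "proper_holomorphic_ball_map f \<longleftrightarrow>
     holomorphic_map_on f (ball 0 1) \<and> f ` ball 0 1 \<subseteq> ball 0 1 \<and>
     (\<forall>K. compact K \<longrightarrow> K \<subseteq> ball 0 1 \<longrightarrow> compact {z \<in> ball 0 1. f z \<in> K})"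
proof -
  let ?X = "top_of_set (ball (0 :: complex ^ 'n) 1)"
  let ?Y = "top_of_set (ball (0 :: complex ^ 'm) 1)"
  have k: "k_space ?Y"
    by (intro locally_compact_imp_k_space locally_compact_space_open_subset)
       (simp_all add: Hausdorff_space_euclidean locally_compact_space_euclidean)
  have kc: "kc_space ?Y"
    by (intro Hausdorff_imp_kc_space Hausdorff_space_subtopology Hausdorff_space_euclidean)
  have cX: "kc_space ?X"
    by (intro Hausdorff_imp_kc_space Hausdorff_space_subtopology Hausdorff_space_euclidean)
  have "proper_map ?X ?Y f \<longleftrightarrow> f \<in> ball 0 1 \<rightarrow> ball 0 1 \<and>
      (\<forall>K. compactin ?Y K \<longrightarrow> compactin ?X {z \<in> ball 0 1. f z \<in> K})"
    using proper_eq_compact_map[OF k kc, of ?X f] cX by simp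
  moreover have "compactin ?Y K \<longleftrightarrow> compact K \<and> K \<subseteq> ball 0 1" for K
    by (metis compactin_subtopology compactin_euclidean_iff)
  moreover have "compactin ?X {z \<in> ball 0 1. f z \<in> K} \<longleftrightarrow> compact {z \<in> ball 0 1. f z \<in> K}" for K
    unfolding compactin_subtopology compactin_euclidean_iff by blast
  ultimately show ?thesis
    by (simp only: proper_holomorphic_ball_map_def image_subset_iff_funcset imp_conjL)
qed

text \<open>
  \<open>f = p/q\<close> as functions on the unit ball.  Nonvanishing of \<open>q\<close> is explicit because
  division by zero is total.
\<close>

definition is_quotient_on_ball ::
    "(complex ^ 'n \<Rightarrow> complex ^ 'm) \<Rightarrow> ('n::finite cpoly) ^ 'm \<Rightarrow> 'n cpoly \<Rightarrow> bool" where
  "is_quotient_on_ball f p q \<longleftrightarrow>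
     (\<forall>z\<in>ball 0 1. cpoly_eval q z \<noteq> 0 \<and> f z = inverse (cpoly_eval q z) *s cpoly_map_eval p z)"

definition rational_proper_ball_map :: "(complex ^ 'n \<Rightarrow> complex ^ 'm) \<Rightarrow> bool" where
  "rational_proper_ball_map f \<longleftrightarrow>
     proper_holomorphic_ball_map f \<and> (\<exists>p q. is_quotient_on_ball f p q)"

text \<open>No nonconstant polynomial divides \<open>q\<close> and all components of \<open>p\<close>.\<close>

definition lowest_terms :: "('n cpoly) ^ 'm \<Rightarrow> 'n cpoly \<Rightarrow> bool" where
  "lowest_terms p q \<longleftrightarrow> (\<forall>r. r dvd q \<longrightarrow> (\<forall>j. r dvd p $ j) \<longrightarrow> r dvd 1)"

text \<open>
  A relation rather than a function: the reduced representation is unique up to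
  a constant factor, so at most one \<open>d\<close> qualifies.
\<close>

definition has_rational_degree :: "(complex ^ 'n::finite \<Rightarrow> complex ^ 'm::finite) \<Rightarrow> nat \<Rightarrow> bool" where
  "has_rational_degree f d \<longleftrightarrow>
     (\<exists>p q. is_quotient_on_ball f p q \<and> lowest_terms p q \<and>
            d = max (cpoly_map_degree p) (cpoly_degree q))"

end

theory Submission
  imports Defs "HOL-Computational_Algebra.Field_as_Ring"
    "HOL-Computational_Algebra.Fundamental_Theorem_Algebra"
    "HOL-Computational_Algebra.Polynomial_Factorial"
begin

text \<open>
  Put \<open>D = 2n - 3\<close>.  There is a monomial map \<open>M\<close> from the ball of \<open>\<complex>\<^sup>2\<close> to the ball of \<open>\<complex>\<^sup>n\<close>,
  sending sphere to sphere, whose components have degree at most \<open>D\<close>, with equality for at least one of them.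
  Its coefficients come from the Lucas polynomials: if \<open>s\<^sub>m\<close> is the \<open>m\<close>-th power sum of the two roots
  of \<open>u\<^sup>2 - x u - y\<close>, then on the line \<open>x + y = 1\<close> these roots are \<open>1\<close> and \<open>-y\<close>, so that
  \<open>s\<^sub>D + y\<^sup>D = 1\<close> there (\<open>ex_monomial_sphere_identity\<close>).

  If \<open>f = p/q\<close> is reduced of degree \<open>d\<close>, then \<open>f \<circ> A \<circ> M\<close>, with a unitary \<open>A\<close> in between, is a
  rational proper map from \<open>B\<^sub>2\<close> to \<open>B\<^sub>N\<close>.  The expected degree is \<open>d D\<close>, but a common
  factor could appear after the substitution.  For the bound it is enough to see that no cancellation
  takes place along one line: restrict \<open>f \<circ> A \<circ> M\<close> to the diagonal \<open>t \<mapsto> (t, t)\<close> of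
  \<open>\<complex>\<^sup>2\<close>.  If the polynomials \<open>p\<^sub>j\<close> and \<open>q\<close> have no common zero on the image curve, and some
  component of degree \<open>d\<close> keeps its leading term, then every representation of the composite
  as a quotient has degree at least \<open>d D\<close> (\<open>degree_times_le_composite_degree\<close>).

  The common zeros of \<open>p\<close> and \<open>q\<close> have codimension two, so a generic curve should avoid them.
  The form of this used here is that some nonzero polynomial \<open>E\<close> has the following property: when
  \<open>E x \<noteq> 0\<close>, the line through \<open>x\<close> in a fixed direction \<open>v\<close> meets no common zero
  (\<open>generic_lines_avoid_common_zeros\<close>).  It replaces resultants and unique factorisation in several
  variables: if it failed, linear algebra over the polynomial functions would give relations
  \<open>b p\<^sub>j = q a\<^sub>j\<close> with \<open>b\<close> of lower degree than \<open>q\<close> in the direction \<open>v\<close>, and then the lemma of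
  Gauss would produce a common factor of \<open>p\<close> and \<open>q\<close>.  Finally the phases of the monomials
  in \<open>M\<close> are free.  Let \<open>A\<close> map the basis vector of a component of degree \<open>D\<close> to a multiple
  of \<open>v\<close>.  The other phases are chosen so that \<open>E\<close> vanishes only finitely often along the
  curve, and the phase of the distinguished component moves the curve off the zeros of \<open>q\<close> at
  these finitely many parameters (\<open>ex_generic_curve\<close>).
\<close>

section \<open>Polynomial functions on complex n-space\<close>

lemma cpoly_eval_superset:
  assumes "finite M" "Poly_Mapping.keys P \<subseteq> M"
  shows "cpoly_eval P z =
    (\<Sum>m\<in>M. Poly_Mapping.lookup P m * (\<Prod>i\<in>UNIV. (z $ i) ^ Poly_Mapping.lookup m i))"
  unfolding cpoly_eval_def
  by (rule sum.mono_neutral_left) (use assms in \<open>auto simp: in_keys_iff\<close>)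

lemma cpoly_eval_add: "cpoly_eval (P + Q) z = cpoly_eval P z + cpoly_eval Q z"
proof -
  let ?M = "Poly_Mapping.keys P \<union> Poly_Mapping.keys Q"
  have "finite ?M" by simp
  moreover have "Poly_Mapping.keys (P + Q) \<subseteq> ?M" by (rule Poly_Mapping.keys_add)
  ultimately show ?thesis
    by (simp add: cpoly_eval_superset[of ?M] lookup_add distrib_right sum.distrib)
qed

lemma cpoly_eval_single:
  "cpoly_eval (Poly_Mapping.single m c) z = c * (\<Prod>i\<in>UNIV. (z $ i) ^ Poly_Mapping.lookup m i)"
  using cpoly_eval_superset[of "{m}" "Poly_Mapping.single m c" z] by simp

lemma cpoly_induct [case_names single add]:
  fixes P :: "'n::finite cpoly"
  assumes "\<And>m c. R (Poly_Mapping.single m c)"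
    and "\<And>P Q. R P \<Longrightarrow> R Q \<Longrightarrow> R (P + Q)"
  shows "R P"
proof -
  have "R (\<Sum>m\<in>M. Poly_Mapping.single m (Poly_Mapping.lookup P m))" if "finite M" for M
    using that by induction (use assms(1)[of 0 0] in \<open>auto intro: assms\<close>)
  moreover have "(\<Sum>m\<in>Poly_Mapping.keys P. Poly_Mapping.single m (Poly_Mapping.lookup P m)) = P"
    by (rule poly_mapping_eqI) (auto simp: lookup_sum lookup_single when_def in_keys_iff)
  ultimately show ?thesis by (metis finite_keys)
qed

lemma cpoly_eval_mult: "cpoly_eval (P * Q) z = cpoly_eval P z * cpoly_eval Q z"
proof (induction P rule: cpoly_induct)
  case (single m c)
  show ?case
  proof (induction Q rule: cpoly_induct)
    case (single l d)
    show ?case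
      by (simp add: mult_single cpoly_eval_single lookup_add power_add prod.distrib)
  qed (simp add: distrib_left cpoly_eval_add)
qed (simp add: distrib_right cpoly_eval_add)

definition polyfun :: "(complex ^ 'n::finite \<Rightarrow> complex) \<Rightarrow> bool" where
  "polyfun f \<longleftrightarrow> f \<in> range cpoly_eval"

lemma polyfun_cpoly_eval [intro, simp]: "polyfun (cpoly_eval P)"
  by (simp add: polyfun_def)

lemma polyfun_const [intro, simp]: "polyfun (\<lambda>_. c)"
proof -
  have "(\<lambda>_. c) = cpoly_eval (Poly_Mapping.single 0 c)"
    by (simp add: fun_eq_iff cpoly_eval_single)
  then show ?thesis unfolding polyfun_def by (rule range_eqI)
qed

lemma polyfun_coord [intro, simp]: "polyfun (\<lambda>z. z $ i)"
proof -
  have "(\<Prod>j\<in>UNIV. (z $ j) ^ Poly_Mapping.lookup (Poly_Mapping.single i 1) j) = z $ i" for z :: "complex ^ 'a"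
  proof -
    have "(\<Prod>j\<in>UNIV. (z $ j) ^ Poly_Mapping.lookup (Poly_Mapping.single i 1) j)
        = (\<Prod>j\<in>UNIV. if j = i then z $ j else 1)"
      by (intro prod.cong) (auto simp: lookup_single when_def)
    then show ?thesis by simp
  qed
  then have "(\<lambda>z. z $ i) = cpoly_eval (Poly_Mapping.single (Poly_Mapping.single i 1) 1)"
    by (simp add: fun_eq_iff cpoly_eval_single)
  then show ?thesis unfolding polyfun_def by (rule range_eqI)
qed

lemma polyfun_add [intro]:
  assumes "polyfun f" "polyfun g" shows "polyfun (\<lambda>z. f z + g z)"
proof -
  obtain P Q where "f = cpoly_eval P" "g = cpoly_eval Q" using assms by (auto simp: polyfun_def)
  then have "(\<lambda>z. f z + g z) = cpoly_eval (P + Q)" by (simp add: fun_eq_iff cpoly_eval_add)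
  then show ?thesis unfolding polyfun_def by (rule range_eqI)
qed

lemma polyfun_mult [intro]:
  assumes "polyfun f" "polyfun g" shows "polyfun (\<lambda>z. f z * g z)"
proof -
  obtain P Q where "f = cpoly_eval P" "g = cpoly_eval Q" using assms by (auto simp: polyfun_def)
  then have "(\<lambda>z. f z * g z) = cpoly_eval (P * Q)" by (simp add: fun_eq_iff cpoly_eval_mult)
  then show ?thesis unfolding polyfun_def by (rule range_eqI)
qed

lemma polyfun_uminus [intro]: "polyfun f \<Longrightarrow> polyfun (\<lambda>z. - f z)"
  using polyfun_mult[OF polyfun_const[of "-1"]] by simp

lemma polyfun_diff [intro]: "polyfun f \<Longrightarrow> polyfun g \<Longrightarrow> polyfun (\<lambda>z. f z - g z)"
  using polyfun_add[OF _ polyfun_uminus, of f g] by simp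

lemma polyfun_power [intro]: "polyfun f \<Longrightarrow> polyfun (\<lambda>z. f z ^ k)"
  by (induction k) auto

lemma polyfun_sum [intro]: "(\<And>a. a \<in> A \<Longrightarrow> polyfun (f a)) \<Longrightarrow> polyfun (\<lambda>z. \<Sum>a\<in>A. f a z)"
  by (induction A rule: infinite_finite_induct) auto

lemma polyfun_prod [intro]: "(\<And>a. a \<in> A \<Longrightarrow> polyfun (f a)) \<Longrightarrow> polyfun (\<lambda>z. \<Prod>a\<in>A. f a z)"
  by (induction A rule: infinite_finite_induct) auto

lemma polyfun_compose:
  assumes "polyfun f" "\<And>i. polyfun (\<lambda>x. G x $ i)"
  shows "polyfun (\<lambda>x. f (G x))"
proof -
  obtain P where "f = cpoly_eval P" using assms by (auto simp: polyfun_def)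
  then show ?thesis unfolding cpoly_eval_def
    by (auto intro!: polyfun_sum polyfun_mult polyfun_prod polyfun_power assms(2))
qed

text \<open>Induction on the variables: collecting the powers of one variable leaves a polynomial in one
  variable with infinitely many zeros, so each of its coefficients vanishes identically in the remaining
  variables.  Through this, identities and divisibility of polynomials can be checked on values.\<close>

lemma monomials_independent:
  fixes c :: "('n \<Rightarrow> nat) \<Rightarrow> complex"
  assumes "finite I" "finite M" "\<And>m i. m \<in> M \<Longrightarrow> i \<notin> I \<Longrightarrow> m i = 0"
    and "\<And>x. (\<Sum>m\<in>M. c m * (\<Prod>i\<in>I. x i ^ m i)) = 0" and "m \<in> M"
  shows "c m = 0"
  using assms
proof (induction I arbitrary: M c m)
  case empty
  then have "M \<subseteq> {\<lambda>_. 0}" by (auto simp: fun_eq_iff)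
  then have "M = {m}" using empty by auto
  with empty.prems(3)[of undefined] show ?case by simp
next
  case (insert j I)
  define k where "k = m j"
  define Mk where "Mk = (\<lambda>m. m(j := 0)) ` {m \<in> M. m j = k}"
  have inj: "inj_on (\<lambda>m. m(j := 0)) {m \<in> M. m j = k}"
    by (auto simp: inj_on_def fun_eq_iff) metis
  have "c ((m(j := 0))(j := k)) = 0"
  proof (rule insert.IH[of Mk "\<lambda>m. c (m(j := k))" "m(j := 0)"], goal_cases finite supp vanish elem)
    case elem
    show ?case using insert.prems(4) unfolding Mk_def k_def by (intro imageI) auto
  next
    case (vanish x)
    define p where "p = (\<Sum>m\<in>M. monom (c m * (\<Prod>i\<in>I. x i ^ m i)) (m j))"
    have "poly p t = 0" for t
    proof -
      have "(\<Prod>i\<in>insert j I. (x(j := t)) i ^ m i) = t ^ m j * (\<Prod>i\<in>I. x i ^ m i)" for m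
      proof -
        have "(\<Prod>i\<in>I. (x(j := t)) i ^ m i) = (\<Prod>i\<in>I. x i ^ m i)"
          using insert.hyps by (intro prod.cong) auto
        then show ?thesis using insert.hyps by simp
      qed
      then show ?thesis using insert.prems(3)[of "x(j := t)"]
        by (simp add: p_def poly_sum poly_monom mult_ac)
    qed
    then have "p = 0" using poly_all_0_iff_0 by blast
    then have "0 = coeff p k" by simp
    also have "\<dots> = (\<Sum>m\<in>{m \<in> M. m j = k}. c m * (\<Prod>i\<in>I. x i ^ m i))"
      using insert.prems(1) by (simp add: p_def coeff_sum if_distrib sum.inter_filter cong: if_cong)
    also have "\<dots> = (\<Sum>m\<in>Mk. c (m(j := k)) * (\<Prod>i\<in>I. x i ^ m i))"
      unfolding Mk_def
    proof (subst sum.reindex[OF inj], intro sum.cong refl)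
      fix m assume m: "m \<in> {m \<in> M. m j = k}"
      then have "(m(j := 0))(j := k) = m" by auto
      moreover have "(\<Prod>i\<in>I. x i ^ (m(j := 0)) i) = (\<Prod>i\<in>I. x i ^ m i)"
        using insert.hyps by (intro prod.cong) auto
      ultimately show "c m * (\<Prod>i\<in>I. x i ^ m i) =
        ((\<lambda>m. c (m(j := k)) * (\<Prod>i\<in>I. x i ^ m i)) \<circ> (\<lambda>m. m(j := 0))) m" by simp
    qed
    finally show ?case by simp
  qed (use insert.prems in \<open>auto simp: Mk_def k_def\<close>)
  then show ?case by (simp add: k_def)
qed

lemma cpoly_coeffs_zero:
  fixes P :: "'n::finite cpoly"
  assumes "finite M"
    and "\<And>z :: complex ^ 'n. (\<Sum>m\<in>M. Poly_Mapping.lookup P m * (\<Prod>i\<in>UNIV. (z $ i) ^ Poly_Mapping.lookup m i)) = 0"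
    and "m \<in> M"
  shows "Poly_Mapping.lookup P m = 0"
proof -
  have inj: "inj_on Poly_Mapping.lookup M" by (auto simp: inj_on_def lookup_inject)
  have "Poly_Mapping.lookup P (Abs_poly_mapping (Poly_Mapping.lookup m)) = 0"
  proof (rule monomials_independent[of UNIV "Poly_Mapping.lookup ` M"
        "\<lambda>f. Poly_Mapping.lookup P (Abs_poly_mapping f)" "Poly_Mapping.lookup m"])
    fix x :: "'n \<Rightarrow> complex"
    show "(\<Sum>m\<in>Poly_Mapping.lookup ` M.
       Poly_Mapping.lookup P (Abs_poly_mapping m) * (\<Prod>i\<in>UNIV. x i ^ m i)) = 0"
      using assms(2)[of "\<chi> i. x i"] by (simp add: sum.reindex[OF inj] lookup_inverse)
  qed (use assms in auto)
  then show ?thesis by (simp add: lookup_inverse)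
qed

lemma cpoly_eval_zero_iff: "(\<forall>z. cpoly_eval P z = 0) \<longleftrightarrow> P = 0"
proof
  assume "\<forall>z. cpoly_eval P z = 0"
  then have "Poly_Mapping.lookup P m = 0" if "m \<in> Poly_Mapping.keys P" for m
    using that by (intro cpoly_coeffs_zero[of "Poly_Mapping.keys P"]) (auto simp: cpoly_eval_def)
  then show "P = 0" by (auto simp: in_keys_iff simp flip: keys_eq_empty)
qed (simp add: cpoly_eval_def)

lemma cpoly_eval_eq_iff: "(\<forall>z. cpoly_eval P z = cpoly_eval Q z) \<longleftrightarrow> P = Q"
proof
  assume *: "\<forall>z. cpoly_eval P z = cpoly_eval Q z"
  have "cpoly_eval (P - Q) z = 0" for z
    using cpoly_eval_add[of "P - Q" Q z] * by simp
  then have "P - Q = 0" using cpoly_eval_zero_iff by blast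
  then show "P = Q" by simp
qed auto

section \<open>Substitution and leading coefficients\<close>

definition mdeg :: "('n::finite \<Rightarrow>\<^sub>0 nat) \<Rightarrow> nat" where
  "mdeg m = (\<Sum>i\<in>UNIV. Poly_Mapping.lookup m i)"

lemma mdeg_le_degree: "m \<in> Poly_Mapping.keys P \<Longrightarrow> mdeg m \<le> cpoly_degree P"
  unfolding cpoly_degree_def mdeg_def by (intro Max_ge) auto

text \<open>The homogeneous part of highest degree, as a function.\<close>

definition top_form :: "'n::finite cpoly \<Rightarrow> complex ^ 'n \<Rightarrow> complex" where
  "top_form P z = (\<Sum>m | m \<in> Poly_Mapping.keys P \<and> mdeg m = cpoly_degree P.
     Poly_Mapping.lookup P m * (\<Prod>i\<in>UNIV. (z $ i) ^ Poly_Mapping.lookup m i))"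

lemma polyfun_top_form: "polyfun (top_form P)"
  unfolding top_form_def[abs_def]
  by (intro polyfun_sum polyfun_mult polyfun_prod polyfun_power polyfun_const polyfun_coord)

lemma top_form_scale: "top_form P (c *s z) = c ^ cpoly_degree P * top_form P z"
  unfolding top_form_def sum_distrib_left
  by (intro sum.cong) (auto simp: power_mult_distrib prod.distrib mdeg_def simp flip: power_sum)

lemma top_form_nonzero:
  fixes P :: "'n::finite cpoly"
  assumes "P \<noteq> 0"
  shows "\<exists>z. top_form P z \<noteq> 0"
proof (rule ccontr)
  assume *: "\<not> ?thesis"
  have ne: "Poly_Mapping.keys P \<noteq> {}" using assms by simp
  have "cpoly_degree P \<in> insert 0 (mdeg ` Poly_Mapping.keys P)"
    unfolding cpoly_degree_def mdeg_def[abs_def] by (intro Max_in) auto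
  moreover have "\<exists>m\<in>Poly_Mapping.keys P. mdeg m = 0" if "cpoly_degree P = 0"
    using ne mdeg_le_degree[of _ P] that by fastforce
  ultimately obtain m where m: "m \<in> Poly_Mapping.keys P" "mdeg m = cpoly_degree P"
    by fastforce
  have "Poly_Mapping.lookup P m = 0"
    by (rule cpoly_coeffs_zero[of "{m. m \<in> Poly_Mapping.keys P \<and> mdeg m = cpoly_degree P}"])
      (use * m in \<open>auto simp: top_form_def\<close>)
  with m show False by (simp add: in_keys_iff)
qed

lemma coeff_mult_top:
  fixes p q :: "'a::comm_ring_1 poly"
  assumes "degree p \<le> a" "degree q \<le> b"
  shows "coeff (p * q) (a + b) = coeff p a * coeff q b"
proof -
  have "coeff (p * q) (a + b) = (\<Sum>i\<le>a+b. coeff p i * coeff q (a + b - i))"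
    by (rule coeff_mult)
  also have "\<dots> = (\<Sum>i\<in>{a}. coeff p i * coeff q (a + b - i))"
  proof (rule sum.mono_neutral_right)
    show "\<forall>i\<in>{..a + b} - {a}. coeff p i * coeff q (a + b - i) = 0"
    proof
      fix i assume i: "i \<in> {..a + b} - {a}"
      show "coeff p i * coeff q (a + b - i) = 0"
      proof (cases "i > a")
        case True
        then show ?thesis using assms by (simp add: coeff_eq_0)
      next
        case False
        then have "degree q < a + b - i" using i assms by auto
        then show ?thesis by (simp add: coeff_eq_0)
      qed
    qed
  qed auto
  finally show ?thesis by simp
qed

lemma coeff_power_top:
  fixes p :: "'a::comm_ring_1 poly"
  assumes "degree p \<le> D"
  shows "degree (p ^ k) \<le> k * D \<and> coeff (p ^ k) (k * D) = coeff p D ^ k"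
proof (induction k)
  case (Suc k)
  then show ?case
    using coeff_mult_top[of p D "p ^ k" "k * D"] degree_mult_le[of p "p ^ k"] assms
    by (auto intro: order.trans)
qed auto

lemma coeff_prod_top:
  fixes G :: "'n \<Rightarrow> 'a::comm_ring_1 poly"
  assumes "finite I" "\<And>i. degree (G i) \<le> D"
  shows "degree (\<Prod>i\<in>I. G i ^ k i) \<le> sum k I * D \<and>
    coeff (\<Prod>i\<in>I. G i ^ k i) (sum k I * D) = (\<Prod>i\<in>I. coeff (G i) D ^ k i)"
  using assms(1)
proof induction
  case (insert j I)
  let ?P = "\<Prod>i\<in>I. G i ^ k i"
  have 1: "degree (G j ^ k j) \<le> k j * D" "coeff (G j ^ k j) (k j * D) = coeff (G j) D ^ k j"
    using coeff_power_top[OF assms(2)] by blast+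
  have "degree (G j ^ k j * ?P) \<le> k j * D + sum k I * D"
    using degree_mult_le[of "G j ^ k j" ?P] 1 insert.IH by linarith
  moreover have "coeff (G j ^ k j * ?P) (k j * D + sum k I * D)
      = coeff (G j) D ^ k j * (\<Prod>i\<in>I. coeff (G i) D ^ k i)"
    using coeff_mult_top[OF 1(1), of ?P "sum k I * D"] 1(2) insert.IH by simp
  ultimately show ?case using insert.hyps by (simp add: algebra_simps)
qed auto

text \<open>When polynomials of degree at most \<open>D\<close> in one variable are substituted, only the monomials of
  top degree reach the degree \<open>cpoly_degree P * D\<close>.  The coefficient ring is left general because
  two instances are needed: complex numbers for a single curve, and polynomial functions of \<open>x\<close> for
  the family of all lines \<open>x + t v\<close> in a fixed direction.\<close>

lemma substitute_top:
  fixes P :: "'n::finite cpoly" and G :: "'n \<Rightarrow> 'a::comm_ring_1 poly" and \<phi> :: "complex \<Rightarrow> 'a"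
  assumes "\<And>i. degree (G i) \<le> D" "D > 0"
  defines "F \<equiv> \<Sum>m\<in>Poly_Mapping.keys P. [:\<phi> (Poly_Mapping.lookup P m):] * (\<Prod>i\<in>UNIV. G i ^ Poly_Mapping.lookup m i)"
  shows "degree F \<le> cpoly_degree P * D"
    and "coeff F (cpoly_degree P * D) = (\<Sum>m | m \<in> Poly_Mapping.keys P \<and> mdeg m = cpoly_degree P.
      \<phi> (Poly_Mapping.lookup P m) * (\<Prod>i\<in>UNIV. coeff (G i) D ^ Poly_Mapping.lookup m i))"
proof -
  let ?M = "\<lambda>m. \<Prod>i\<in>UNIV. G i ^ Poly_Mapping.lookup m i"
  have M: "degree (?M m) \<le> mdeg m * D"
     "coeff (?M m) (mdeg m * D) = (\<Prod>i\<in>UNIV. coeff (G i) D ^ Poly_Mapping.lookup m i)" for m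
    using coeff_prod_top[of UNIV G D "Poly_Mapping.lookup m"] assms(1) by (auto simp: mdeg_def)
  have le: "degree ([:\<phi> (Poly_Mapping.lookup P m):] * ?M m) \<le> mdeg m * D" for m
    using degree_mult_le[of "[:\<phi> (Poly_Mapping.lookup P m):]" "?M m"] M(1)[of m] by simp
  show "degree F \<le> cpoly_degree P * D"
    unfolding F_def
    by (rule degree_sum_le, simp, rule order.trans[OF le]) (simp add: mdeg_le_degree)
  have "coeff F (cpoly_degree P * D) =
    (\<Sum>m\<in>Poly_Mapping.keys P. \<phi> (Poly_Mapping.lookup P m) * coeff (?M m) (cpoly_degree P * D))"
    by (simp add: F_def coeff_sum)
  also have "\<dots> = (\<Sum>m | m \<in> Poly_Mapping.keys P \<and> mdeg m = cpoly_degree P.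
      \<phi> (Poly_Mapping.lookup P m) * coeff (?M m) (cpoly_degree P * D))"
  proof (rule sum.mono_neutral_right)
    show "\<forall>m\<in>Poly_Mapping.keys P - {m \<in> Poly_Mapping.keys P. mdeg m = cpoly_degree P}.
      \<phi> (Poly_Mapping.lookup P m) * coeff (?M m) (cpoly_degree P * D) = 0"
    proof
      fix m assume "m \<in> Poly_Mapping.keys P - {m \<in> Poly_Mapping.keys P. mdeg m = cpoly_degree P}"
      then have "mdeg m < cpoly_degree P" using mdeg_le_degree[of m P] by auto
      then have "degree (?M m) < cpoly_degree P * D"
        using M(1)[of m] assms(2) by (meson le_less_trans mult_less_mono1)
      then show "\<phi> (Poly_Mapping.lookup P m) * coeff (?M m) (cpoly_degree P * D) = 0"
        by (simp add: coeff_eq_0)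
    qed
  qed auto
  also have "\<dots> = (\<Sum>m | m \<in> Poly_Mapping.keys P \<and> mdeg m = cpoly_degree P.
      \<phi> (Poly_Mapping.lookup P m) * (\<Prod>i\<in>UNIV. coeff (G i) D ^ Poly_Mapping.lookup m i))"
  proof (rule sum.cong[OF refl])
    fix m assume "m \<in> {m \<in> Poly_Mapping.keys P. mdeg m = cpoly_degree P}"
    then show "\<phi> (Poly_Mapping.lookup P m) * coeff (?M m) (cpoly_degree P * D) =
      \<phi> (Poly_Mapping.lookup P m) * (\<Prod>i\<in>UNIV. coeff (G i) D ^ Poly_Mapping.lookup m i)"
      using M(2)[of m] by simp
  qed
  finally show "coeff F (cpoly_degree P * D) = (\<Sum>m | m \<in> Poly_Mapping.keys P \<and> mdeg m = cpoly_degree P.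
      \<phi> (Poly_Mapping.lookup P m) * (\<Prod>i\<in>UNIV. coeff (G i) D ^ Poly_Mapping.lookup m i))" .
qed

lemma restrict_to_curve:
  fixes P :: "'n::finite cpoly" and G :: "'n \<Rightarrow> complex poly"
  assumes "\<And>i. degree (G i) \<le> D" "D > 0"
  obtains F where "\<And>t. poly F t = cpoly_eval P (\<chi> i. poly (G i) t)"
    "degree F \<le> cpoly_degree P * D"
    "coeff F (cpoly_degree P * D) = top_form P (\<chi> i. coeff (G i) D)"
proof
  let ?F = "\<Sum>m\<in>Poly_Mapping.keys P. [:id (Poly_Mapping.lookup P m):] * (\<Prod>i\<in>UNIV. G i ^ Poly_Mapping.lookup m i)"
  show "poly ?F t = cpoly_eval P (\<chi> i. poly (G i) t)" for t
    by (simp add: poly_sum poly_prod cpoly_eval_def)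
  show "degree ?F \<le> cpoly_degree P * D" by (rule substitute_top(1)[OF assms])
  show "coeff ?F (cpoly_degree P * D) = top_form P (\<chi> i. coeff (G i) D)"
    by (subst substitute_top(2)[OF assms]) (simp_all add: top_form_def)
qed

lemma polyfun_line:
  assumes "polyfun f"
  obtains F where "\<And>t. poly F t = f (x + t *s v)"
proof -
  obtain P where P: "f = cpoly_eval P" using assms by (auto simp: polyfun_def)
  obtain F where F: "\<And>t. poly F t = cpoly_eval P (\<chi> i. poly [:x $ i, v $ i:] t)"
    by (rule restrict_to_curve[where G = "\<lambda>i. [:x $ i, v $ i:]" and D = 1 and P = P]) auto
  have "(\<chi> i. poly [:x $ i, v $ i:] t) = x + t *s v" for t
    by (simp add: vec_eq_iff)
  then have "poly F t = f (x + t *s v)" for t using F P by simp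
  then show thesis by (rule that)
qed

lemma poly_eq_if_agree:
  fixes F G :: "complex poly"
  assumes "\<And>t. poly F t = poly G t"
  shows "F = G"
  using poly_eq_poly_eq_iff[of F G] assms by auto

lemma poly_nonzero_avoid:
  fixes F :: "complex poly"
  assumes "infinite S" "poly F a \<noteq> 0"
  obtains t where "t \<in> S" "poly F t \<noteq> 0"
proof -
  have "F \<noteq> 0" using assms by auto
  then have "finite {t. poly F t = 0}" by (rule poly_roots_finite)
  with assms(1) have "\<not> S \<subseteq> {t. poly F t = 0}" using finite_subset by blast
  then show thesis using that by blast
qed

lemma polyfun_nonzero_both:
  assumes "polyfun f" "polyfun g" "f x \<noteq> 0" "g y \<noteq> 0"
  obtains z where "f z \<noteq> 0" "g z \<noteq> 0"
proof -
  obtain F where F: "\<And>t. poly F t = f (x + t *s (y - x))"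
    using polyfun_line[OF assms(1), of x "y - x"] by blast
  obtain G where G: "\<And>t. poly G t = g (x + t *s (y - x))"
    using polyfun_line[OF assms(2), of x "y - x"] by blast
  have "poly F 0 \<noteq> 0" "poly G 1 \<noteq> 0" using assms(3,4) by (simp_all add: F G)
  then have "F \<noteq> 0" "G \<noteq> 0" by auto
  then have "F * G \<noteq> 0" by simp
  then obtain t where "poly (F * G) t \<noteq> 0" using poly_all_0_iff_0 by blast
  then show thesis using that F G by auto
qed

text \<open>A product of infinite sets is Zariski dense: the coordinates of a point with nonzero value are
  moved one after the other, each time avoiding the finitely many zeros of a polynomial in one
  variable.\<close>

lemma polyfun_nonzero_on_product:
  fixes f :: "complex ^ 'n::finite \<Rightarrow> complex"
  assumes "polyfun f" "f x0 \<noteq> 0" "\<And>i. infinite (S i)"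
  obtains x where "\<And>i. x $ i \<in> S i" "f x \<noteq> 0"
proof -
  have "\<exists>x. (\<forall>i\<in>I. x $ i \<in> S i) \<and> f x \<noteq> 0" if "finite I" for I :: "'n set"
    using that
  proof induction
    case empty
    then show ?case using assms(2) by auto
  next
    case (insert j I)
    then obtain x where x: "\<forall>i\<in>I. x $ i \<in> S i" "f x \<noteq> 0" by blast
    obtain F where F: "\<And>t. poly F t = f ((x - x $ j *s axis j 1) + t *s axis j 1)"
      using polyfun_line[OF assms(1), of "x - x $ j *s axis j 1" "axis j 1"] by blast
    have "poly F (x $ j) \<noteq> 0" using x(2) by (simp add: F)
    then obtain t where t: "t \<in> S j" "poly F t \<noteq> 0"
      using poly_nonzero_avoid[OF assms(3)] by blast
    let ?y = "(x - x $ j *s axis j 1) + t *s axis j 1"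
    have "?y $ i = (if i = j then t else x $ i)" for i by (simp add: axis_def)
    then have "\<forall>i\<in>insert j I. ?y $ i \<in> S i" using x(1) t(1) by simp
    moreover have "f ?y \<noteq> 0" using t(2) F by simp
    ultimately show ?case by blast
  qed
  from this[of UNIV] show thesis using that by auto
qed

section \<open>The ring of polynomial functions\<close>

text \<open>The polynomial functions form an integral domain, which makes the theory of univariate
  polynomials over it, in particular pseudo-division, available.\<close>

typedef (overloaded) ('n::finite) polyfn = "{f :: complex ^ 'n \<Rightarrow> complex. polyfun f}"
  morphisms ev Abs_polyfn
  by (rule exI[of _ "\<lambda>_. 0"]) simp

setup_lifting type_definition_polyfn

lemma polyfun_ev [intro, simp]: "polyfun (ev f)"
  using ev by auto

lemma polyfn_eqI: "(\<And>x. ev f x = ev g x) \<Longrightarrow> f = g"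
  by (simp add: ev_inject[symmetric] fun_eq_iff)

instantiation polyfn :: (finite) comm_ring_1
begin

lift_definition zero_polyfn :: "'a polyfn" is "\<lambda>_. 0" by simp
lift_definition one_polyfn :: "'a polyfn" is "\<lambda>_. 1" by simp
lift_definition plus_polyfn :: "'a polyfn \<Rightarrow> 'a polyfn \<Rightarrow> 'a polyfn" is "\<lambda>f g x. f x + g x"
  by (rule polyfun_add)
lift_definition times_polyfn :: "'a polyfn \<Rightarrow> 'a polyfn \<Rightarrow> 'a polyfn" is "\<lambda>f g x. f x * g x"
  by (rule polyfun_mult)
lift_definition minus_polyfn :: "'a polyfn \<Rightarrow> 'a polyfn \<Rightarrow> 'a polyfn" is "\<lambda>f g x. f x - g x"
  by (rule polyfun_diff)
lift_definition uminus_polyfn :: "'a polyfn \<Rightarrow> 'a polyfn" is "\<lambda>f x. - f x"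
  by (rule polyfun_uminus)

instance
  by standard (transfer; simp add: fun_eq_iff algebra_simps)+

end

lemmas ev_simps [simp] =
  zero_polyfn.rep_eq one_polyfn.rep_eq plus_polyfn.rep_eq times_polyfn.rep_eq
  minus_polyfn.rep_eq uminus_polyfn.rep_eq

lemma polyfn_nonzero: "f \<noteq> 0 \<longleftrightarrow> (\<exists>x. ev f x \<noteq> 0)"
  using polyfn_eqI[of f 0] by auto

instance polyfn :: (finite) idom
proof
  fix f g :: "'a polyfn"
  assume "f \<noteq> 0" "g \<noteq> 0"
  then obtain x y where "ev f x \<noteq> 0" "ev g y \<noteq> 0" by (auto simp: polyfn_nonzero)
  then obtain z where "ev f z \<noteq> 0" "ev g z \<noteq> 0"
    using polyfun_nonzero_both[of "ev f" "ev g" x y] by auto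
  then show "f * g \<noteq> 0" by (auto simp: polyfn_nonzero)
qed

lift_definition const_fn :: "complex \<Rightarrow> 'n::finite polyfn" is "\<lambda>c _. c" by simp
lift_definition coord_fn :: "'n::finite \<Rightarrow> 'n polyfn" is "\<lambda>i x. x $ i" by simp

lemmas ev_const_fn [simp] = const_fn.rep_eq
lemmas ev_coord_fn [simp] = coord_fn.rep_eq

text \<open>Applied to the evaluation at a point and to the restriction to a line.\<close>

locale coefficient_hom =
  fixes h :: "'a::comm_ring_1 \<Rightarrow> 'b::comm_ring_1"
  assumes h_0 [simp]: "h 0 = 0" and h_1 [simp]: "h 1 = 1"
    and h_add [simp]: "h (a + b) = h a + h b" and h_mult [simp]: "h (a * b) = h a * h b"
begin

lemma h_sum: "h (sum f A) = (\<Sum>a\<in>A. h (f a))"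
  by (induction A rule: infinite_finite_induct) auto

lemma map_add: "map_poly h (p + q) = map_poly h p + map_poly h q"
  by (rule poly_eqI) (simp add: coeff_map_poly)

lemma map_mult: "map_poly h (p * q) = map_poly h p * map_poly h q"
  by (rule poly_eqI) (simp add: coeff_map_poly coeff_mult h_sum)

lemma map_1: "map_poly h 1 = 1"
  by (rule poly_eqI) (simp add: coeff_map_poly)

lemma map_smult: "map_poly h (smult a p) = smult (h a) (map_poly h p)"
  by (rule poly_eqI) (simp add: coeff_map_poly)

lemma map_power: "map_poly h (p ^ k) = map_poly h p ^ k"
  by (induction k) (simp_all add: map_1 map_mult)

lemma map_sum: "map_poly h (sum f A) = (\<Sum>a\<in>A. map_poly h (f a))"
  by (induction A rule: infinite_finite_induct) (auto simp: map_add)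

lemma map_prod: "map_poly h (prod f A) = (\<Prod>a\<in>A. map_poly h (f a))"
  by (induction A rule: infinite_finite_induct) (auto simp: map_mult map_1)

end

text \<open>A univariate polynomial over the polynomial functions is a family of complex polynomials
  parametrised by points; this is the member of the family at \<open>x\<close>.\<close>

definition spec :: "complex ^ 'n::finite \<Rightarrow> 'n polyfn poly \<Rightarrow> complex poly" where
  "spec x = map_poly (\<lambda>f. ev f x)"

interpretation spec: coefficient_hom "\<lambda>f. ev f x"
  rewrites "map_poly (\<lambda>f. ev f x) \<equiv> spec x"
  by unfold_locales (simp_all add: spec_def)

lemma coeff_spec [simp]: "coeff (spec x F) k = ev (coeff F k) x"
  by (simp add: spec_def coeff_map_poly)

lemma spec_eqI: "(\<And>x. spec x F = spec x G) \<Longrightarrow> F = G"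
  by (rule poly_eqI, rule polyfn_eqI) (metis coeff_spec)

lemma spec_0 [simp]: "spec x 0 = 0"
  by (rule poly_eqI) simp

lemma degree_spec_le: "degree (spec x F) \<le> degree F"
  by (rule degree_le) (simp add: coeff_eq_0)

lemma degree_spec_eq: "ev (lead_coeff F) x \<noteq> 0 \<Longrightarrow> degree (spec x F) = degree F"
  using degree_spec_le[of x F] le_degree[of "spec x F" "degree F"] by simp

text \<open>The restrictions to all lines in the direction \<open>v\<close> form one such family.  Its leading
  coefficient is a constant when the top form does not vanish at \<open>v\<close>; then the family behaves like
  a monic polynomial.\<close>

lemma expand_along_direction:
  fixes P :: "'n::finite cpoly"
  obtains F where "\<And>x t. poly (spec x F) t = cpoly_eval P (x + t *s v)"
    "degree F \<le> cpoly_degree P" "coeff F (cpoly_degree P) = const_fn (top_form P v)"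
proof -
  let ?G = "\<lambda>i. [:coord_fn i, const_fn (v $ i):] :: 'n polyfn poly"
  let ?F = "\<Sum>m\<in>Poly_Mapping.keys P. [:const_fn (Poly_Mapping.lookup P m):] * (\<Prod>i\<in>UNIV. ?G i ^ Poly_Mapping.lookup m i)"
  have G: "\<And>i. degree (?G i) \<le> 1" by simp
  have [simp]: "spec x [:a, b:] = [:ev a x, ev b x:]" "spec x [:a:] = [:ev a x:]" for x a b
    by (simp_all add: spec_def map_poly_pCons)
  have [simp]: "ev (sum f A) x = (\<Sum>a\<in>A. ev (f a) x)" for f :: "_ \<Rightarrow> 'n polyfn" and A x
    by (rule spec.h_sum)
  have evp: "ev (f ^ k) x = ev f x ^ k" for f :: "'n polyfn" and k x
    by (induction k) simp_all
  have evpr: "ev (prod f A) x = (\<Prod>a\<in>A. ev (f a) x)" for f :: "_ \<Rightarrow> 'n polyfn" and A x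
    by (induction A rule: infinite_finite_induct) simp_all
  have "poly (spec x ?F) t = cpoly_eval P (x + t *s v)" for x t
    by (simp add: spec.map_sum spec.map_mult spec.map_prod spec.map_power spec.map_smult
      poly_sum poly_prod cpoly_eval_def)
  moreover have "degree ?F \<le> cpoly_degree P" using substitute_top(1)[where G = ?G and D = 1 and P = P and \<phi> = const_fn] by simp
  moreover have "coeff ?F (cpoly_degree P) = const_fn (top_form P v)"
    using substitute_top(2)[where G = ?G and D = 1 and P = P and \<phi> = const_fn]
    by (intro polyfn_eqI) (simp add: top_form_def evp evpr)
  ultimately show thesis using that by blast
qed

section \<open>Generic lines avoid the common zeros of coprime polynomials\<close>

text \<open>Fraction-free Gaussian elimination, one unknown at a time.  The rows \<open>M\<close> form a homogeneous linear
  system over the polynomial functions.  Either there is a nonzero solution with polynomial entries, or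
  the product \<open>D\<close> of the pivots is nonzero, and wherever \<open>D\<close> does not vanish the specialised
  system has only the trivial solution.\<close>

lemma linear_system_dichotomy:
  fixes M :: "('i \<Rightarrow> 'n::finite polyfn) set"
  assumes "finite I"
  shows "(\<exists>b. (\<exists>i\<in>I. b i \<noteq> 0) \<and> (\<forall>r\<in>M. (\<Sum>i\<in>I. r i * b i) = 0)) \<or>
    (\<exists>D. D \<noteq> 0 \<and> (\<forall>x. ev D x \<noteq> 0 \<longrightarrow>
      (\<forall>b. (\<forall>r\<in>M. (\<Sum>i\<in>I. ev (r i) x * b i) = 0) \<longrightarrow> (\<forall>i\<in>I. b i = 0))))"
  using assms
proof (induction I arbitrary: M)
  case empty
  show ?case by (intro disjI2 exI[of _ 1]) auto
next
  case (insert j I)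
  show ?case
  proof (cases "\<forall>r\<in>M. r j = 0")
    case True
    have "(\<Sum>i\<in>insert j I. r i * (if i = j then 1 else 0)) = 0" if "r \<in> M" for r
      using True that insert.hyps by (simp add: if_distrib cong: if_cong)
    then show ?thesis by (intro disjI1 exI[of _ "\<lambda>i. if i = j then 1 else 0"]) auto
  next
    case False
    then obtain s where s: "s \<in> M" "s j \<noteq> 0" by blast
    \<comment> \<open>eliminate the unknown \<open>j\<close> with the pivot \<open>s j\<close>\<close>
    define M' where "M' = (\<lambda>r i. s j * r i - r j * s i) ` M"
    from insert.IH[of M'] show ?thesis
    proof (elim disjE exE conjE)
      fix b assume b: "\<exists>i\<in>I. b i \<noteq> 0" "\<forall>r\<in>M'. (\<Sum>i\<in>I. r i * b i) = 0"
      define b' where "b' = (\<lambda>i. if i = j then - (\<Sum>i\<in>I. s i * b i) else s j * b i)"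
      have sum: "(\<Sum>i\<in>insert j I. r i * b' i) = 0" if r: "r \<in> M" for r
      proof -
        have "(\<Sum>i\<in>I. r i * b' i) = (\<Sum>i\<in>I. s j * r i * b i)"
          using insert.hyps by (intro sum.cong) (auto simp: b'_def mult_ac)
        moreover have "(\<Sum>i\<in>I. (s j * r i - r j * s i) * b i) = 0"
          using b(2) r by (auto simp: M'_def)
        then have "(\<Sum>i\<in>I. s j * r i * b i) = r j * (\<Sum>i\<in>I. s i * b i)"
          by (simp add: left_diff_distrib sum_subtractf sum_distrib_left mult.assoc)
        ultimately show ?thesis using insert.hyps by (simp add: b'_def)
      qed
      from b(1) obtain i where "i \<in> I" "b i \<noteq> 0" by blast
      then have "b' i \<noteq> 0" "i \<in> insert j I" using s insert.hyps by (auto simp: b'_def)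
      then show ?thesis using sum by blast
    next
      fix D assume D: "D \<noteq> 0"
        "\<forall>x. ev D x \<noteq> 0 \<longrightarrow> (\<forall>b. (\<forall>r\<in>M'. (\<Sum>i\<in>I. ev (r i) x * b i) = 0) \<longrightarrow> (\<forall>i\<in>I. b i = 0))"
      show ?thesis
      proof (intro disjI2 exI[of _ "D * s j"] conjI allI impI)
        show "D * s j \<noteq> 0" using D s by simp
        fix x b assume x: "ev (D * s j) x \<noteq> 0"
          and b: "\<forall>r\<in>M. (\<Sum>i\<in>insert j I. ev (r i) x * b i) = 0"
        have "(\<Sum>i\<in>I. ev (r i) x * b i) = 0" if "r \<in> M'" for r
        proof -
          obtain r0 where r0: "r0 \<in> M" "r = (\<lambda>i. s j * r0 i - r0 j * s i)"
            using \<open>r \<in> M'\<close> by (auto simp: M'_def)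
          have *: "ev (r' j) x * b j + (\<Sum>i\<in>I. ev (r' i) x * b i) = 0" if "r' \<in> M" for r'
            using b that insert.hyps by auto
          have "(\<Sum>i\<in>I. ev (r i) x * b i) =
             ev (s j) x * (\<Sum>i\<in>I. ev (r0 i) x * b i) - ev (r0 j) x * (\<Sum>i\<in>I. ev (s i) x * b i)"
            by (simp add: r0 algebra_simps sum_subtractf sum_distrib_left)
          also have "\<dots> = 0"
            using *[OF r0(1)] *[OF s(1)] by algebra
          finally show ?thesis .
        qed
        then have zero: "\<forall>i\<in>I. b i = 0" using D(2) x by auto
        then have "(\<Sum>i\<in>I. ev (s i) x * b i) = 0" by simp
        then have "ev (s j) x * b j = 0" using b s(1) insert.hyps by auto
        then have "b j = 0" using x by simp
        then show "\<forall>i\<in>insert j I. b i = 0" using zero by simp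
      qed
    qed
  qed
qed

text \<open>The equations \<open>b p\<^sub>j = q a\<^sub>j\<close>, compared at the coefficient of degree \<open>k\<close>, as a linear
  system.  The unknown \<open>(None, i)\<close> is the coefficient of degree \<open>i\<close> of \<open>b\<close>, and
  \<open>(Some l, i)\<close> is that of \<open>a\<^sub>l\<close>.\<close>

definition cross_row :: "('m \<Rightarrow> 'a::comm_ring_1 poly) \<Rightarrow> 'a poly \<Rightarrow> 'm \<times> nat \<Rightarrow> 'm option \<times> nat \<Rightarrow> 'a" where
  "cross_row p q = (\<lambda>(j, k) (l, i). case l of
     None \<Rightarrow> coeff (monom 1 i * p j) k
   | Some l \<Rightarrow> if l = j then - coeff (monom 1 i * q) k else 0)"

lemma cross_row_sum:
  fixes p :: "'m::finite \<Rightarrow> 'a::comm_ring_1 poly"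
  shows "(\<Sum>y\<in>Pair None ` {..e} \<union> (\<lambda>(l, i). (Some l, i)) ` (UNIV \<times> {..d}). cross_row p q (j, k) y * b y) =
    coeff ((\<Sum>i\<le>e. monom (b (None, i)) i) * p j - q * (\<Sum>i\<le>d. monom (b (Some j, i)) i)) k"
proof -
  have m: "coeff (monom c i * f) k = c * coeff (monom 1 i * f) k" for c i and f :: "'a poly"
    by (simp add: coeff_monom_mult)
  have "(\<Sum>y\<in>Pair None ` {..e} \<union> (\<lambda>(l, i). (Some l, i)) ` (UNIV \<times> {..d}). cross_row p q (j, k) y * b y)
    = (\<Sum>y\<in>Pair None ` {..e}. cross_row p q (j, k) y * b y)
     + (\<Sum>y\<in>(\<lambda>(l, i). (Some l, i)) ` (UNIV \<times> {..d}). cross_row p q (j, k) y * b y)"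
    by (rule sum.union_disjoint) auto
  also have "(\<Sum>y\<in>Pair None ` {..e}. cross_row p q (j, k) y * b y) =
     (\<Sum>i\<le>e. coeff (monom 1 i * p j) k * b (None, i))"
    by (subst sum.reindex) (auto simp: inj_on_def cross_row_def)
  also have "(\<Sum>y\<in>(\<lambda>(l, i). (Some l, i)) ` (UNIV \<times> {..d}). cross_row p q (j, k) y * b y) =
     (\<Sum>(l, i)\<in>UNIV \<times> {..d}. cross_row p q (j, k) (Some l, i) * b (Some l, i))"
    by (subst sum.reindex) (auto simp: inj_on_def case_prod_beta)
  also have "\<dots> = (\<Sum>l\<in>UNIV. \<Sum>i\<le>d. cross_row p q (j, k) (Some l, i) * b (Some l, i))"
    by (simp add: sum.cartesian_product)
  also have "\<dots> = (\<Sum>l\<in>UNIV. if l = j then \<Sum>i\<le>d. - coeff (monom 1 i * q) k * b (Some j, i) else 0)"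
    by (intro sum.cong) (auto simp: cross_row_def)
  also have "\<dots> = (\<Sum>i\<le>d. - coeff (monom 1 i * q) k * b (Some j, i))" by simp
  finally show ?thesis
    by (simp add: sum_distrib_left sum_distrib_right coeff_sum m[of "b _"] sum_negf mult.commute[of q] mult.commute[of "b _"])
qed

text \<open>A common zero \<open>t\<close> of the specialised polynomials at \<open>x\<close> yields a solution of the cross
  equations at \<open>x\<close>: divide everything by the linear factor of \<open>t\<close>, which makes the cofactor
  \<open>b\<close> of lower degree than \<open>Q\<close>.  So either such zeros occur only where \<open>D\<close> vanishes, or there
  is a polynomial family of such cofactors.\<close>

lemma cofactor_dichotomy:
  fixes Q :: "'n::finite polyfn poly" and P :: "'m::finite \<Rightarrow> 'n polyfn poly"
  assumes lead: "\<And>x. ev (lead_coeff Q) x \<noteq> 0"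
  shows "(\<exists>D. D \<noteq> 0 \<and> (\<forall>x t. ev D x \<noteq> 0 \<longrightarrow>
      \<not> (poly (spec x Q) t = 0 \<and> (\<forall>j. poly (spec x (P j)) t = 0)))) \<or>
    (\<exists>b a. b \<noteq> 0 \<and> degree b < degree Q \<and> (\<forall>j. b * P j = Q * a j))"
proof (cases "degree Q = 0")
  case True
  have "poly (spec x Q) t \<noteq> 0" for x t
  proof -
    have "degree (spec x Q) = 0" using degree_spec_le[of x Q] True by simp
    then obtain c where c: "spec x Q = [:c:]" by (rule degree_eq_zeroE)
    moreover have "c \<noteq> 0" using lead[of x] True coeff_spec[of x Q 0] c by simp
    ultimately show ?thesis by simp
  qed
  then show ?thesis by (intro disjI1 exI[of _ 1]) auto
next
  case False
  define e where "e = degree Q - 1"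
  have e: "degree Q = Suc e" using False by (simp add: e_def)
  define d where "d = Max (range (\<lambda>j. degree (P j)))"
  have d: "degree (P j) \<le> d" for j unfolding d_def by (intro Max_ge) auto
  define I :: "('m option \<times> nat) set"
    where "I = Pair None ` {..e} \<union> (\<lambda>(l, i). (Some l, i)) ` (UNIV \<times> {..d})"
  have I: "(None, i) \<in> I \<longleftrightarrow> i \<le> e" "(Some l, i) \<in> I \<longleftrightarrow> i \<le> d" for i l by (auto simp: I_def)
  have "finite I" by (simp add: I_def)
  from linear_system_dichotomy[OF this, of "range (cross_row P Q)"] show ?thesis
  proof (elim disjE exE conjE)
    fix b assume b: "\<exists>i\<in>I. b i \<noteq> 0" "\<forall>r\<in>range (cross_row P Q). (\<Sum>i\<in>I. r i * b i) = 0"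
    define B where "B = (\<Sum>i\<le>e. monom (b (None, i)) i)"
    define A where "A = (\<lambda>j. \<Sum>i\<le>d. monom (b (Some j, i)) i)"
    have eq: "B * P j = Q * A j" for j
    proof -
      have "coeff (B * P j - Q * A j) k = 0" for k
        using b(2) cross_row_sum[of P Q j k b e d] by (auto simp: I_def B_def A_def)
      then have "B * P j - Q * A j = 0" by (intro poly_eqI) simp
      then show ?thesis by simp
    qed
    have cB: "coeff B i = (if i \<le> e then b (None, i) else 0)" for i
      by (simp add: B_def coeff_sum)
    have cA: "coeff (A j) i = (if i \<le> d then b (Some j, i) else 0)" for i j
      by (simp add: A_def coeff_sum)
    have "degree B \<le> e" by (rule degree_le) (simp add: cB)
    moreover have "B \<noteq> 0"
    proof
      assume B0: "B = 0"
      have "Q \<noteq> 0" using False by auto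
      then have "A j = 0" for j using eq[of j] B0 by simp
      then have "b i = 0" if "i \<in> I" for i
        using that B0 cB[of "snd i"] cA[of "the (fst i)" "snd i"]
        by (cases i; cases "fst i") (auto simp: I split: if_splits)
      with b(1) show False by blast
    qed
    ultimately show ?thesis using eq e by (intro disjI2 exI[of _ B] exI[of _ A]) auto
  next
    fix D assume D: "D \<noteq> 0" "\<forall>x. ev D x \<noteq> 0 \<longrightarrow>
      (\<forall>b. (\<forall>r\<in>range (cross_row P Q). (\<Sum>i\<in>I. ev (r i) x * b i) = 0) \<longrightarrow> (\<forall>i\<in>I. b i = 0))"
    have False if x: "ev D x \<noteq> 0" and t: "poly (spec x Q) t = 0" "\<forall>j. poly (spec x (P j)) t = 0" for x t
    proof -
      obtain B where B: "spec x Q = [:- t, 1:] * B" using t(1) by (auto simp: poly_eq_0_iff_dvd)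
      have "\<forall>j. \<exists>A. spec x (P j) = [:- t, 1:] * A" using t(2) by (metis dvdE poly_eq_0_iff_dvd)
      then obtain A where A: "\<And>j. spec x (P j) = [:- t, 1:] * A j" by metis
      have Q0: "spec x Q \<noteq> 0" using lead[of x] by (metis coeff_spec coeff_0)
      then have B0: "B \<noteq> 0" using B by auto
      have deg1: "degree ([:- t, 1:] * F) = Suc (degree F)" if "F \<noteq> 0" for F
        using degree_mult_eq[of "[:- t, 1:]" F] that by (simp del: mult_pCons_left)
      have "degree (spec x Q) = Suc (degree B)" by (simp only: B deg1[OF B0])
      then have dB: "degree B \<le> e"
        using degree_spec_le[of x Q] e by simp
      have dA: "degree (A j) \<le> d" for j
      proof (cases "A j = 0")
        case False
        have "degree (spec x (P j)) = Suc (degree (A j))" by (simp only: A deg1[OF False])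
        then show ?thesis using degree_spec_le[of x "P j"] d[of j] by simp
      qed simp
      define b where "b = (\<lambda>(l, i). case l of None \<Rightarrow> coeff B i | Some j \<Rightarrow> coeff (A j) i)"
      have *: "ev (cross_row P Q y i) x = cross_row (\<lambda>j. spec x (P j)) (spec x Q) y i" for y i
        by (cases y; cases i) (auto simp: cross_row_def coeff_monom_mult split: option.splits)
      have "(\<Sum>i\<in>I. ev (cross_row P Q (j, k) i) x * b i) = 0" for j k
        unfolding * I_def cross_row_sum
        by (simp add: b_def poly_as_sum_of_monoms'[OF dB] poly_as_sum_of_monoms'[OF dA] A B mult_ac
          del: mult_pCons_left mult_pCons_right)
      then have z: "\<forall>i\<in>I. b i = 0" using D(2) x by fast
      have "coeff B i = 0" for i
      proof (cases "i \<le> e")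
        case True
        then show ?thesis using z I(1)[of i] by (auto simp: b_def)
      next
        case False
        then show ?thesis using dB by (simp add: coeff_eq_0)
      qed
      then have "B = 0" by (intro poly_eqI) simp
      with B0 show False by simp
    qed
    with D(1) show ?thesis by blast
  qed
qed

lemma division_by_unit_lead:
  fixes F G :: "'a::idom poly"
  assumes "lead_coeff G dvd 1"
  obtains q r where "F = G * q + r" "r = 0 \<or> degree r < degree G"
proof -
  have G: "G \<noteq> 0" using assms by auto
  obtain q r where qr: "pseudo_divmod F G = (q, r)" by (cases "pseudo_divmod F G")
  define a where "a = lead_coeff G ^ (Suc (degree F) - degree G)"
  have "a dvd 1" using assms dvd_power_same[of "lead_coeff G" 1] by (simp add: a_def)
  then obtain u where u: "1 = a * u" by (rule dvdE)
  have "smult a F = G * q + r" using pseudo_divmod(1)[OF G qr] by (simp add: a_def)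
  then have "smult u (smult a F) = G * smult u q + smult u r" by (simp add: smult_add_right)
  then have "F = G * smult u q + smult u r" using u by (simp add: mult.commute)
  moreover have "smult u r = 0 \<or> degree (smult u r) < degree G"
    using pseudo_divmod(2)[OF G qr] degree_smult_le[of u r] by auto
  ultimately show thesis by (rule that)
qed

lemma is_unit_const_fn: "c \<noteq> 0 \<Longrightarrow> const_fn c dvd 1"
proof (rule dvdI)
  assume "c \<noteq> 0"
  then show "1 = const_fn c * const_fn (1 / c)" by (intro polyfn_eqI) simp
qed

definition on_line :: "complex ^ 'n::finite \<Rightarrow> complex ^ 'n \<Rightarrow> 'n polyfn \<Rightarrow> complex poly" where
  "on_line y u f = (SOME F. \<forall>w. poly F w = ev f (y + w *s u))"

lemma poly_on_line [simp]: "poly (on_line y u f) w = ev f (y + w *s u)"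
proof -
  have "\<exists>F. \<forall>w. poly F w = ev f (y + w *s u)"
    using polyfun_line[of "ev f" y u] by auto
  from someI_ex[OF this] show ?thesis by (simp add: on_line_def)
qed

interpretation on_line: coefficient_hom "on_line y u"
  by unfold_locales (rule poly_eq_if_agree; simp)+

text \<open>Choose the direction \<open>u\<close> so that the restrictions of \<open>D\<close> have a constant nonzero leading
  coefficient.  Then division with remainder is possible over the polynomial functions, and the remainder
  vanishes on each line by assumption.\<close>

lemma dvd_if_dvd_on_lines:
  fixes D A :: "'n::finite polyfn"
  assumes "D \<noteq> 0" and dvd: "\<And>y u. on_line y u D \<noteq> 0 \<Longrightarrow> on_line y u D dvd on_line y u A"
  shows "D dvd A"
proof -
  obtain P where P: "ev D = cpoly_eval P" using polyfun_ev[of D] by (auto simp: polyfun_def)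
  obtain R where R: "ev A = cpoly_eval R" using polyfun_ev[of A] by (auto simp: polyfun_def)
  have "P \<noteq> 0"
  proof
    assume "P = 0"
    then have "ev D x = 0" for x by (simp add: P cpoly_eval_def)
    then show False using assms(1) polyfn_nonzero by blast
  qed
  then obtain u where u: "top_form P u \<noteq> 0" using top_form_nonzero by blast
  obtain F where F: "\<And>x t. poly (spec x F) t = cpoly_eval P (x + t *s u)"
    "degree F \<le> cpoly_degree P" "coeff F (cpoly_degree P) = const_fn (top_form P u)"
    using expand_along_direction[of P u] by blast
  obtain G where G: "\<And>x t. poly (spec x G) t = cpoly_eval R (x + t *s u)"
    "degree G \<le> cpoly_degree R" "coeff G (cpoly_degree R) = const_fn (top_form R u)"
    using expand_along_direction[of R u] by blast
  have unit: "coeff F (cpoly_degree P) dvd 1" using F(3) u is_unit_const_fn by simp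
  then have "coeff F (cpoly_degree P) \<noteq> 0" by auto
  then have deg: "degree F = cpoly_degree P" using F(2) le_degree by (metis le_antisym)
  have lead: "ev (lead_coeff F) x \<noteq> 0" for x using u F(3) by (simp add: deg)
  have "lead_coeff F dvd 1" using unit deg by simp
  then obtain q r where qr: "G = F * q + r" "r = 0 \<or> degree r < degree F"
    by (rule division_by_unit_lead)
  have "spec x r = 0" for x
  proof -
    have FD: "spec x F = on_line x u D" "spec x G = on_line x u A"
      by (rule poly_eq_if_agree; simp add: F(1) G(1) P R)+
    have "spec x F \<noteq> 0" using lead[of x] by (metis coeff_spec coeff_0)
    then have "spec x F dvd spec x G" using dvd[of x u] FD by simp
    then have "spec x F dvd spec x r" by (simp add: qr(1) spec.map_add spec.map_mult dvd_add_right_iff)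
    moreover have "spec x r = 0 \<or> degree (spec x r) < degree (spec x F)"
      using qr(2) degree_spec_eq[OF lead[of x]] degree_spec_le[of x r] by auto
    ultimately show ?thesis using dvd_imp_degree_le leD by blast
  qed
  then have "r = 0" by (intro spec_eqI) simp
  have "A = D * coeff q 0"
  proof (rule polyfn_eqI)
    fix x
    have "poly (spec x G) 0 = poly (spec x F) 0 * poly (spec x q) 0"
      by (simp add: qr(1) \<open>r = 0\<close> spec.map_mult)
    then show "ev A x = ev (D * coeff q 0) x"
      using F(1)[of x 0] G(1)[of x 0] by (simp add: P R poly_0_coeff_0)
  qed
  then show ?thesis by simp
qed

text \<open>The lemma of Gauss: since \<open>Q\<close> is primitive, the contents of \<open>b\<close> and \<open>s\<close> multiply, up to a
  unit, to \<open>a\<close>, and so do their leading coefficients.  Hence the leading coefficient of \<open>b\<close> is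
  associated to the content of \<open>b\<close>.\<close>

lemma lead_coeff_dvd_coeffs_univariate:
  fixes b s Q :: "complex poly poly"
  assumes eq: "b * s = smult a Q" and "a \<noteq> 0" and unit: "is_unit (lead_coeff Q)"
  shows "lead_coeff b dvd coeff b i"
proof -
  have "Polynomial.content Q dvd 1" using unit content_dvd_coeff[where p = Q and n = "degree Q"] dvd_trans by blast
  then have cQ: "Polynomial.content Q = 1" by simp
  have Q0: "Q \<noteq> 0" using unit by auto
  have "Polynomial.content (b * s) = normalize a" by (simp add: eq cQ)
  then have c: "Polynomial.content b * Polynomial.content s = normalize a" by (simp add: content_mult)
  obtain u where u: "lead_coeff b = Polynomial.content b * u" using content_dvd_coeff by (rule dvdE)
  obtain v where v: "lead_coeff s = Polynomial.content s * v" using content_dvd_coeff by (rule dvdE)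
  have "lead_coeff b * lead_coeff s = a * lead_coeff Q"
    using arg_cong[OF eq, of lead_coeff] by (simp add: lead_coeff_mult)
  then have "normalize a * (u * v) = a * lead_coeff Q" by (simp add: u v mult_ac flip: c)
  moreover have "a * lead_coeff Q dvd normalize a * 1" using unit by simp
  ultimately have "normalize a * (u * v) dvd normalize a * 1" by simp
  then have "u * v dvd 1" using assms(2) by (subst (asm) dvd_mult_cancel_left) auto
  then have "is_unit u" using dvd_mult_left by blast
  then have "lead_coeff b dvd Polynomial.content b" by (simp add: u)
  then show ?thesis using content_dvd_coeff dvd_trans by blast
qed

text \<open>For coefficients in several variables this follows without unique factorisation there, because
  divisibility can be tested on lines.  With a power of the leading coefficient of \<open>b\<close> as the
  factor of \<open>Q\<close>, that factor is nonzero on every line on which the leading coefficient is.\<close>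

lemma lead_coeff_dvd_coeffs:
  fixes b s Q :: "'n::finite polyfn poly"
  assumes eq: "b * s = smult (lead_coeff b ^ k) Q" and unit: "lead_coeff Q dvd 1" and "b \<noteq> 0"
  shows "lead_coeff b dvd coeff b i"
proof (rule dvd_if_dvd_on_lines)
  show "lead_coeff b \<noteq> 0" using \<open>b \<noteq> 0\<close> by simp
  fix y u :: "complex ^ 'n"
  let ?l = "on_line y u" and ?m = "map_poly (on_line y u)"
  assume nz: "?l (lead_coeff b) \<noteq> 0"
  have lead: "lead_coeff (?m F) = ?l (lead_coeff F)" if "?l (lead_coeff F) \<noteq> 0" for F
  proof -
    have "degree (?m F) = degree F"
      using that by (intro antisym degree_le le_degree) (auto simp: coeff_map_poly coeff_eq_0)
    then show ?thesis by (simp add: coeff_map_poly)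
  qed
  obtain c where c: "1 = lead_coeff Q * c" using unit by (rule dvdE)
  have "1 = ?l (lead_coeff Q) * ?l c" by (simp flip: on_line.h_mult c)
  then have uQ: "?l (lead_coeff Q) dvd 1" by (rule dvdI)
  then have uQ0: "?l (lead_coeff Q) \<noteq> 0" by auto
  have pow: "?l (f ^ k) = ?l f ^ k" for f k by (induction k) simp_all
  have "?m b * ?m s = smult (?l (lead_coeff b) ^ k) (?m Q)"
    by (simp add: eq on_line.map_smult pow flip: on_line.map_mult)
  then have "lead_coeff (?m b) dvd coeff (?m b) i"
    by (rule lead_coeff_dvd_coeffs_univariate) (use nz uQ uQ0 in \<open>auto simp: lead\<close>)
  then show "?l (lead_coeff b) dvd ?l (coeff b i)"
    unfolding lead[OF nz] by (simp add: coeff_map_poly)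
qed

text \<open>Take a cofactor \<open>b\<close> of least degree.  By minimality the pseudo-remainder of \<open>Q\<close> modulo \<open>b\<close>
  vanishes, so \<open>b\<close> divides a multiple of \<open>Q\<close> by a power of its leading coefficient.  By the lemma
  of Gauss this leading coefficient can be divided out; the quotient \<open>b'\<close> is monic, and the complementary
  factor \<open>S\<close> of \<open>Q\<close> is the common factor.\<close>

lemma common_factor_from_cofactor:
  fixes Q :: "'n::finite polyfn poly" and P :: "'m \<Rightarrow> 'n polyfn poly"
  assumes unit: "lead_coeff Q dvd 1" and "b0 \<noteq> 0" "degree b0 < degree Q" "\<And>j. Q dvd b0 * P j"
  obtains S where "lead_coeff S dvd 1" "0 < degree S" "S dvd Q" "\<And>j. S dvd P j"
proof -
  define R where "R = (\<lambda>b. b \<noteq> 0 \<and> (\<forall>j. Q dvd b * P j))"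
  have "R b0" using assms by (simp add: R_def)
  from ex_has_least_nat[of R b0 degree, OF this]
  obtain b where b: "R b" "\<And>r. R r \<Longrightarrow> degree b \<le> degree r" by blast
  have b0: "b \<noteq> 0" and bP: "\<And>j. Q dvd b * P j" using b(1) by (auto simp: R_def)
  have deg: "degree b < degree Q" using b(2)[OF \<open>R b0\<close>] assms(3) by simp
  have min: "r = 0" if "\<And>j. Q dvd r * P j" "r = 0 \<or> degree r < degree b" for r
  proof (rule ccontr)
    assume "r \<noteq> 0"
    then have "R r" "degree r < degree b" using that by (auto simp: R_def)
    then show False using b(2)[of r] by simp
  qed
  define D where "D = lead_coeff b"
  have D: "D \<noteq> 0" using b0 by (simp add: D_def)
  obtain s r where sr: "pseudo_divmod Q b = (s, r)" by (cases "pseudo_divmod Q b")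
  define k where "k = Suc (degree Q) - degree b"
  have eq: "smult (D ^ k) Q = b * s + r" using pseudo_divmod(1)[OF b0 sr] by (simp add: D_def k_def)
  have "r = 0"
  proof (rule min)
    show "r = 0 \<or> degree r < degree b" by (rule pseudo_divmod(2)[OF b0 sr])
    fix j
    have "r * P j = Q * smult (D ^ k) (P j) - (b * P j) * s"
    proof -
      have "r = smult (D ^ k) Q - b * s" using eq by simp
      then show ?thesis by (simp add: left_diff_distrib right_diff_distrib mult_ac)
    qed
    then show "Q dvd r * P j" by (simp only: dvd_diff dvd_triv_left dvd_mult2[OF bP])
  qed
  then have "b * s = smult (lead_coeff b ^ k) Q" using eq by (simp add: D_def)
  then have "D dvd coeff b i" for i
    unfolding D_def by (rule lead_coeff_dvd_coeffs[OF _ unit b0])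
  then have "[:D:] dvd b" by (simp add: const_poly_dvd_iff)
  then obtain b' where "b = [:D:] * b'" by (rule dvdE)
  then have b': "b = smult D b'" by simp
  have "lead_coeff b = D * lead_coeff b'" using lead_coeff_smult[of D b'] unfolding b'[symmetric] .
  then have "lead_coeff b' = 1" using D unfolding D_def[symmetric] by simp
  moreover have "degree b' = degree b" "b' \<noteq> 0" using b0 by (auto simp: b' D)
  ultimately have lb': "lead_coeff b' = 1" "degree b' = degree b" "b' \<noteq> 0" by blast+
  obtain S r' where S: "Q = b' * S + r'" "r' = 0 \<or> degree r' < degree b'"
    using division_by_unit_lead[of b' Q] lb' by auto
  have "smult D r' = 0"
  proof (rule min)
    show "smult D r' = 0 \<or> degree (smult D r') < degree b" using S(2) lb' D by auto
    fix j
    have "r' = Q - b' * S" using S(1) by simp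
    then have "smult D r' * P j = Q * smult D (P j) - (b * P j) * S"
      by (simp add: b' left_diff_distrib right_diff_distrib smult_diff_right mult_ac)
    then show "Q dvd smult D r' * P j" by (simp only: dvd_diff dvd_triv_left dvd_mult2[OF bP])
  qed
  then have QS: "Q = b' * S" using D S(1) by simp
  have Q0: "Q \<noteq> 0" using unit by auto
  have lS: "lead_coeff S = lead_coeff Q" using lb' by (simp add: QS lead_coeff_mult)
  have "S \<noteq> 0" using Q0 QS by auto
  then have "degree Q = degree b' + degree S" using lb' by (simp add: QS degree_mult_eq)
  then have dS: "0 < degree S" using deg lb' by simp
  have "S dvd P j" for j
  proof -
    obtain a where "b * P j = Q * a" using bP[of j] by (rule dvdE)
    then have "b' * smult D (P j) = b' * (S * a)" by (simp add: b' QS mult_ac)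
    then have a: "smult D (P j) = S * a" using lb' mult_left_cancel by blast
    obtain c r'' where c: "P j = S * c + r''" "r'' = 0 \<or> degree r'' < degree S"
      using division_by_unit_lead[of S "P j"] lS unit by metis
    have *: "smult D r'' = S * (a - smult D c)"
    proof -
      have "r'' = P j - S * c" using c(1) by simp
      then have "smult D r'' = smult D (P j) - S * smult D c" by (simp add: smult_diff_right)
      then show ?thesis by (simp add: a right_diff_distrib)
    qed
    have "r'' = 0"
    proof (rule ccontr)
      assume r: "r'' \<noteq> 0"
      have "S dvd smult D r''" unfolding * by simp
      moreover have "smult D r'' \<noteq> 0" using r D by simp
      ultimately have "degree S \<le> degree r''" using dvd_imp_degree_le[of S "smult D r''"] D by simp
      then show False using c(2) r by simp
    qed
    then show ?thesis using c(1) by simp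
  qed
  then show thesis using that[of S] lS unit dS QS by simp
qed

lemma complex_poly_has_root:
  fixes F :: "complex poly"
  assumes "degree F \<noteq> 0"
  shows "\<exists>t. poly F t = 0"
proof -
  have "\<not> (\<exists>a l. a \<noteq> 0 \<and> l = 0 \<and> F = pCons a l)" using assms by auto
  then show ?thesis by (rule fundamental_theorem_of_algebra_alt)
qed

lemma poly_eq_sum_upto:
  fixes F :: "complex poly"
  assumes "degree F \<le> n"
  shows "poly F t = (\<Sum>k\<le>n. coeff F k * t ^ k)"
  by (subst poly_as_sum_of_monoms'[OF assms, symmetric]) (simp add: poly_sum poly_monom)

text \<open>A common factor \<open>S\<close> of the restrictions to the lines in the direction \<open>v\<close> has to be turned into
  a common factor of the polynomials themselves.  Normalise the base point of a line by the linear
  functional \<open>\<tau>\<close> with \<open>\<tau> v = 1\<close>: each \<open>x\<close> is the point with parameter \<open>\<tau> x\<close> on the line through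
  \<open>x - \<tau> x v\<close>, and evaluating \<open>S\<close> there gives a polynomial in \<open>x\<close>.  It is not a unit, because \<open>S\<close> has
  positive degree on each line and therefore a zero.\<close>

lemma generic_lines_avoid_common_zeros:
  fixes p :: "('n::finite cpoly) ^ 'm::finite" and q :: "'n cpoly"
  assumes low: "lowest_terms p q" and v: "top_form q v \<noteq> 0"
  obtains E x0 where "polyfun E" "E x0 \<noteq> 0"
    "\<And>x t. E x \<noteq> 0 \<Longrightarrow> cpoly_eval q (x + t *s v) = 0 \<Longrightarrow> \<exists>j. cpoly_eval (p $ j) (x + t *s v) \<noteq> 0"
proof -
  obtain Q where Q: "\<And>x t. poly (spec x Q) t = cpoly_eval q (x + t *s v)"
    "degree Q \<le> cpoly_degree q" "coeff Q (cpoly_degree q) = const_fn (top_form q v)"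
    using expand_along_direction[of q v] by blast
  have "\<forall>j. \<exists>P. \<forall>x t. poly (spec x P) t = cpoly_eval (p $ j) (x + t *s v)"
    by (metis expand_along_direction)
  then obtain P where P: "\<And>j x t. poly (spec x (P j)) t = cpoly_eval (p $ j) (x + t *s v)" by metis
  have unit: "coeff Q (cpoly_degree q) dvd 1" using Q(3) v is_unit_const_fn by simp
  then have "coeff Q (cpoly_degree q) \<noteq> 0" by auto
  then have deg: "degree Q = cpoly_degree q" using Q(2) le_degree by (metis le_antisym)
  have lead: "ev (lead_coeff Q) x \<noteq> 0" for x using v Q(3) by (simp add: deg)
  have "\<nexists>b a. b \<noteq> 0 \<and> degree b < degree Q \<and> (\<forall>j. b * P j = Q * a j)"
  proof
    assume "\<exists>b a. b \<noteq> 0 \<and> degree b < degree Q \<and> (\<forall>j. b * P j = Q * a j)"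
    then obtain b a where b: "b \<noteq> 0" "degree b < degree Q" "\<And>j. b * P j = Q * a j" by blast
    have "Q dvd b * P j" for j using b(3) by simp
    then obtain S where S: "lead_coeff S dvd 1" "0 < degree S" "S dvd Q" "\<And>j. S dvd P j"
      using common_factor_from_cofactor[of Q b P] unit b deg by metis
    have "v \<noteq> 0"
    proof
      assume "v = 0"
      then have "top_form q v = 0 ^ cpoly_degree q * top_form q v"
        using top_form_scale[of q 0 v] by (metis vector_smult_lzero)
      also have "\<dots> = 0" using b(2) deg by simp
      finally have "top_form q v = 0" .
      then show False using v by simp
    qed
    then obtain i where i: "v $ i \<noteq> 0" by (auto simp: vec_eq_iff)
    define \<tau> where "\<tau> = (\<lambda>x :: complex ^ 'n. x $ i / v $ i)"
    define twist where "twist = (\<lambda>F x. poly (spec (x - \<tau> x *s v) F) (\<tau> x))"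
    have pt: "polyfun \<tau>"
      unfolding \<tau>_def divide_inverse by (intro polyfun_mult polyfun_coord polyfun_const)
    have poly: "polyfun (twist F)" for F
    proof -
      have "twist F = (\<lambda>x. \<Sum>k\<le>degree F. ev (coeff F k) (x - \<tau> x *s v) * \<tau> x ^ k)"
        unfolding twist_def by (rule ext) (simp add: poly_eq_sum_upto[OF degree_spec_le])
      moreover have "polyfun (\<lambda>x. ev (coeff F k) (x - \<tau> x *s v))" for k
        by (rule polyfun_compose) (auto intro!: polyfun_diff polyfun_mult pt)
      ultimately show ?thesis
        by (auto intro!: polyfun_sum polyfun_mult polyfun_power pt)
    qed
    have "\<exists>R. cpoly_eval R = twist F" for F using poly[of F] by (auto simp: polyfun_def)
    then obtain R where R: "\<And>F. cpoly_eval (R F) = twist F" by metis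
    have dvd: "R S dvd f" if dv: "S dvd F" and ev: "\<And>x t. poly (spec x F) t = cpoly_eval f (x + t *s v)" for F f
    proof -
      obtain T where T: "F = S * T" using dv by (rule dvdE)
      have "cpoly_eval f x = cpoly_eval (R S * R T) x" for x
        using ev[of "x - \<tau> x *s v" "\<tau> x"]
        by (simp add: cpoly_eval_mult R twist_def T spec.map_mult)
      then have "f = R S * R T" using cpoly_eval_eq_iff by blast
      then show ?thesis by simp
    qed
    have "R S dvd 1"
      using low dvd[OF S(3) Q(1)] dvd[OF S(4) P] by (auto simp: lowest_terms_def)
    then obtain T where T: "1 = R S * T" by (rule dvdE)
    have "ev (lead_coeff S) 0 \<noteq> 0"
    proof -
      obtain c where "1 = lead_coeff S * c" using S(1) by (rule dvdE)
      then have "ev (lead_coeff S) 0 * ev c 0 = 1" by (metis times_polyfn.rep_eq one_polyfn.rep_eq)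
      then show ?thesis by auto
    qed
    then have "degree (spec 0 S) \<noteq> 0" using degree_spec_eq S(2) by fastforce
    then obtain t where t: "poly (spec 0 S) t = 0"
      using complex_poly_has_root by blast
    have "twist S (t *s v) = 0" using i t by (simp add: twist_def \<tau>_def)
    moreover have "cpoly_eval 1 (t *s v) = twist S (t *s v) * cpoly_eval T (t *s v)"
      by (subst T) (simp add: cpoly_eval_mult R)
    moreover have "cpoly_eval 1 (t *s v) = 1"
      using cpoly_eval_single[of 0 1 "t *s v"] by simp
    ultimately show False by simp
  qed
  then obtain D where D: "D \<noteq> 0" "\<And>x t. ev D x \<noteq> 0 \<Longrightarrow>
      \<not> (poly (spec x Q) t = 0 \<and> (\<forall>j. poly (spec x (P j)) t = 0))"
    using cofactor_dichotomy[OF lead, of P] by blast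
  obtain x0 where "ev D x0 \<noteq> 0" using D(1) polyfn_nonzero by blast
  then show thesis by (rule that[OF polyfun_ev]) (use D(2) Q(1) P in auto)
qed

section \<open>Reduced fractions\<close>

text \<open>Uniqueness of reduced fractions in one variable, by removing the roots of \<open>B\<close> one at a time: at
  a root of \<open>B\<close> some \<open>A j\<close> does not vanish, so \<open>Q\<close> has to vanish.\<close>

lemma proportional_if_no_common_zero:
  fixes A P :: "'m \<Rightarrow> complex poly" and B Q :: "complex poly"
  assumes "\<And>j. A j * Q = B * P j" "B \<noteq> 0" "\<And>t. poly B t = 0 \<Longrightarrow> \<exists>j. poly (A j) t \<noteq> 0"
  obtains u where "Q = u * B" "\<And>j. P j = u * A j"
proof -
  have "\<exists>u. Q = u * B \<and> (\<forall>j. P j = u * A j)"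
    using assms
  proof (induction "degree B" arbitrary: B Q)
    case 0
    then obtain c where c: "B = [:c:]" "c \<noteq> 0" by (metis degree_eq_zeroE pCons_0_0)
    have "P j = smult (1 / c) Q * A j" for j
    proof -
      have "smult (1 / c) (smult c (P j)) = smult (1 / c) (A j * Q)" using 0(2)[of j] c by simp
      then show ?thesis using c(2) by (simp add: mult.commute)
    qed
    moreover have "Q = smult (1 / c) Q * B" using c by simp
    ultimately show ?case by blast
  next
    case (Suc d)
    obtain a where a: "poly B a = 0"
      using complex_poly_has_root[of B] Suc(2) by auto
    then obtain j where "poly (A j) a \<noteq> 0" using Suc.prems(3) by blast
    moreover have "poly (A j) a * poly Q a = 0"
      using arg_cong[OF Suc.prems(1)[of j], of "\<lambda>p. poly p a"] a by simp
    ultimately have "poly Q a = 0" by simp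
    then obtain Q1 where Q1: "Q = [:- a, 1:] * Q1" by (auto simp: poly_eq_0_iff_dvd)
    obtain B1 where B1: "B = [:- a, 1:] * B1" using a by (auto simp: poly_eq_0_iff_dvd)
    have "B1 \<noteq> 0" using Suc.prems(2) B1 by auto
    moreover from this have "degree B = Suc (degree B1)"
      unfolding B1 by (subst degree_mult_eq) auto
    then have "d = degree B1" using Suc(2) by simp
    moreover have "A j * Q1 = B1 * P j" for j
    proof -
      have eq: "[:- a, 1:] * (A j * Q1) = [:- a, 1:] * (B1 * P j)"
        using Suc.prems(1)[of j] unfolding Q1 B1 by (simp only: mult_ac)
      have "[:- a, 1:] \<noteq> 0" by simp
      from mult_left_cancel[OF this, THEN iffD1, OF eq] show ?thesis .
    qed
    moreover have "\<exists>j. poly (A j) t \<noteq> 0" if "poly B1 t = 0" for t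
      using Suc.prems(3)[of t] that by (simp add: B1)
    ultimately obtain u where "Q1 = u * B1" "\<forall>j. P j = u * A j"
      using Suc(1)[of B1 Q1] by blast
    then show ?case unfolding Q1 B1 by (metis mult.left_commute)
  qed
  then show thesis using that by blast
qed

lemma cpoly_eval_0 [simp]: "cpoly_eval 0 z = 0"
  by (simp add: cpoly_eval_def)

lemma cpoly_eval_1 [simp]: "cpoly_eval 1 z = 1"
  using cpoly_eval_single[of 0 1 z] by simp

text \<open>Restrict to a line through the origin on which neither top form vanishes.\<close>

lemma cpoly_degree_mult_ge:
  fixes r s :: "'n::finite cpoly"
  assumes "r \<noteq> 0" "s \<noteq> 0"
  shows "cpoly_degree r + cpoly_degree s \<le> cpoly_degree (r * s)"
proof -
  obtain v where v: "top_form r v \<noteq> 0" "top_form s v \<noteq> 0"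
    using top_form_nonzero assms polyfun_nonzero_both polyfun_top_form by metis
  have "\<exists>F. (\<forall>t. poly F t = cpoly_eval P (t *s v)) \<and> degree F \<le> cpoly_degree P
    \<and> coeff F (cpoly_degree P) = top_form P v" for P :: "'n cpoly"
  proof -
    have line: "(\<chi> i. poly [:0, v $ i:] t) = t *s v" "(\<chi> i. coeff [:0, v $ i:] 1) = v" for t
      by (simp_all add: vec_eq_iff)
    obtain F where "\<And>t. poly F t = cpoly_eval P (\<chi> i. poly [:0, v $ i:] t)"
      "degree F \<le> cpoly_degree P * 1"
      "coeff F (cpoly_degree P * 1) = top_form P (\<chi> i. coeff [:0, v $ i:] 1)"
      by (rule restrict_to_curve[where G = "\<lambda>i. [:0, v $ i:]" and D = 1 and P = P]) auto
    then show ?thesis unfolding line mult_1_right by blast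
  qed
  then obtain F where F: "\<And>P t. poly (F P) t = cpoly_eval P (t *s v)"
    "\<And>P. degree (F P) \<le> cpoly_degree P" "\<And>P. coeff (F P) (cpoly_degree P) = top_form P v"
    by metis
  have deg: "degree (F P) = cpoly_degree P" "F P \<noteq> 0" if "top_form P v \<noteq> 0" for P
    using that F(2,3)[of P] le_degree[of "F P" "cpoly_degree P"] by auto
  have "F (r * s) = F r * F s"
    by (rule poly_eq_if_agree) (simp add: F(1) cpoly_eval_mult)
  then have "degree (F (r * s)) = cpoly_degree r + cpoly_degree s"
    using v by (simp add: degree_mult_eq deg)
  then show ?thesis using F(2)[of "r * s"] by simp
qed

lemma cpoly_degree_0_imp_unit:
  fixes r :: "'n::finite cpoly"
  assumes "r \<noteq> 0" "cpoly_degree r = 0"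
  shows "r dvd 1"
proof -
  have "m = 0" if m: "m \<in> Poly_Mapping.keys r" for m
  proof (rule poly_mapping_eqI)
    have "mdeg m = 0" using mdeg_le_degree[OF m] assms(2) by simp
    then show "Poly_Mapping.lookup m i = Poly_Mapping.lookup 0 i" for i by (simp add: mdeg_def)
  qed
  then have "Poly_Mapping.keys r \<subseteq> {0}" by blast
  then have r: "r = Poly_Mapping.single 0 (Poly_Mapping.lookup r 0)"
    by (intro poly_mapping_eqI) (auto simp: lookup_single when_def in_keys_iff)
  define c where "c = Poly_Mapping.lookup r 0"
  have c: "r = Poly_Mapping.single 0 c" using r unfolding c_def .
  then have "c \<noteq> 0" using assms(1) by auto
  then have "r * Poly_Mapping.single 0 (1 / c) = 1" unfolding c by (simp add: mult_single)
  then show ?thesis by (metis dvd_triv_left)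
qed

text \<open>A denominator of least degree works, since dividing out a common factor that is not a unit would
  lower its degree.\<close>

lemma ex_lowest_terms:
  fixes f :: "complex ^ 'n::finite \<Rightarrow> complex ^ 'm::finite"
  assumes "is_quotient_on_ball f p q"
  obtains p' q' where "is_quotient_on_ball f p' q'" "lowest_terms p' q'"
proof -
  from assms have "\<exists>p. is_quotient_on_ball f p q" by blast
  from ex_has_least_nat[of "\<lambda>q. \<exists>p. is_quotient_on_ball f p q" q cpoly_degree, OF this]
  obtain p q where pq: "is_quotient_on_ball f p q"
    and min: "\<And>p' q'. is_quotient_on_ball f p' q' \<Longrightarrow> cpoly_degree q \<le> cpoly_degree q'" by blast
  have "lowest_terms p q"
    unfolding lowest_terms_def
  proof (intro allI impI)
    fix r assume "r dvd q" "\<forall>j. r dvd p $ j"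
    then have "\<exists>s. q = r * s" "\<forall>j. \<exists>t. p $ j = r * t" by (auto simp: dvd_def)
    from this(1) choice[OF this(2)] obtain s t where s: "q = r * s" and t: "\<And>j. p $ j = r * t j"
      by blast
    have "is_quotient_on_ball f (\<chi> j. t j) s"
      using pq by (auto simp: is_quotient_on_ball_def s t cpoly_eval_mult cpoly_map_eval_def vec_eq_iff
        field_simps)
    then have "cpoly_degree q \<le> cpoly_degree s" by (rule min)
    moreover have "q \<noteq> 0" using pq by (auto simp: is_quotient_on_ball_def dest!: bspec[of _ _ 0])
    then have "r \<noteq> 0" "s \<noteq> 0" using s by auto
    ultimately show "r dvd 1"
      using cpoly_degree_mult_ge[of r s] cpoly_degree_0_imp_unit[of r] by (simp add: s)
  qed
  then show thesis using that pq by blast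
qed

section \<open>Composition with polynomial maps of balls\<close>

definition complex_diff :: "(complex ^ 'n \<Rightarrow> complex) \<Rightarrow> complex ^ 'n \<Rightarrow> bool" where
  "complex_diff f z \<longleftrightarrow> (\<exists>D. (f has_derivative D) (at z) \<and> (\<forall>c v. D (c *s v) = c * D v))"

lemma complex_diff_const: "complex_diff (\<lambda>_. c) z"
  unfolding complex_diff_def by (intro exI[of _ "\<lambda>_. 0"]) simp

lemma complex_diff_coord: "complex_diff (\<lambda>z. z $ i) (z :: complex ^ 'n::finite)"
  unfolding complex_diff_def
  by (intro exI[of _ "\<lambda>z. z $ i"] conjI bounded_linear_imp_has_derivative bounded_linear_vec_nth) simp

lemma complex_diff_add:
  assumes "complex_diff f z" "complex_diff g z" shows "complex_diff (\<lambda>z. f z + g z) z"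
proof -
  obtain D E where "(f has_derivative D) (at z)" "\<forall>c v. D (c *s v) = c * D v"
    "(g has_derivative E) (at z)" "\<forall>c v. E (c *s v) = c * E v"
    using assms by (auto simp: complex_diff_def)
  then show ?thesis unfolding complex_diff_def
    by (intro exI[of _ "\<lambda>v. D v + E v"]) (auto intro!: has_derivative_add simp: distrib_left)
qed

lemma complex_diff_mult:
  assumes "complex_diff f z" "complex_diff g z" shows "complex_diff (\<lambda>z. f z * g z) z"
proof -
  obtain D E where "(f has_derivative D) (at z)" "\<forall>c v. D (c *s v) = c * D v"
    "(g has_derivative E) (at z)" "\<forall>c v. E (c *s v) = c * E v"
    using assms by (auto simp: complex_diff_def)
  then show ?thesis unfolding complex_diff_def
    by (intro exI[of _ "\<lambda>v. f z * E v + D v * g z"] conjI has_derivative_mult)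
      (simp_all add: distrib_left mult_ac)
qed

lemma polyfun_complex_diff:
  assumes "polyfun f" shows "complex_diff f z"
proof -
  have pow: "complex_diff (\<lambda>z. z $ i ^ k) z" for i k and z :: "complex ^ 'n::finite"
    by (induction k) (auto intro: complex_diff_const complex_diff_mult complex_diff_coord)
  have prd: "complex_diff (\<lambda>z. \<Prod>i\<in>I. z $ i ^ k i) z" for I k and z :: "complex ^ 'n::finite"
    by (induction I rule: infinite_finite_induct) (auto intro: complex_diff_const complex_diff_mult pow)
  have "complex_diff (\<lambda>z. \<Sum>m\<in>M. c m * (\<Prod>i\<in>UNIV. z $ i ^ k m i)) z"
    for M and c :: "_ \<Rightarrow> complex" and k and z :: "complex ^ 'n::finite"
    by (induction M rule: infinite_finite_induct)
      (simp_all add: complex_diff_const complex_diff_add complex_diff_mult prd)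
  moreover obtain P where "f = cpoly_eval P" using assms by (auto simp: polyfun_def)
  ultimately show ?thesis by (simp add: cpoly_eval_def[abs_def])
qed

lemma polynomial_map_has_complex_derivative:
  fixes G :: "complex ^ 'k::finite \<Rightarrow> complex ^ 'n::finite"
  assumes "\<And>i. polyfun (\<lambda>z. G z $ i)"
  obtains D where "(G has_derivative D) (at z)" "\<And>c v. D (c *s v) = c *s D v"
proof -
  have "\<forall>i. \<exists>D. ((\<lambda>z. G z $ i) has_derivative D) (at z) \<and> (\<forall>c v. D (c *s v) = c * D v)"
    using polyfun_complex_diff[OF assms] by (simp add: complex_diff_def)
  then obtain D where D: "\<And>i. ((\<lambda>z. G z $ i) has_derivative D i) (at z)"
    "\<And>i c v. D i (c *s v) = c * D i v" by metis
  have lin: "bounded_linear (axis i :: complex \<Rightarrow> complex ^ 'n)" for i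
    unfolding linear_conv_bounded_linear[symmetric]
    by (rule linearI) (auto simp: axis_def vec_eq_iff)
  have "((\<lambda>z. \<Sum>i\<in>UNIV. axis i (G z $ i)) has_derivative (\<lambda>v. \<Sum>i\<in>UNIV. axis i (D i v))) (at z)"
    by (intro has_derivative_sum bounded_linear.has_derivative[OF lin] D)
  moreover have "(\<Sum>i\<in>UNIV. axis i (y $ i)) = y" for y :: "complex ^ 'n"
    by (simp add: vec_eq_iff axis_def if_distrib cong: if_cong)
  ultimately have "(G has_derivative (\<lambda>v. \<Sum>i\<in>UNIV. axis i (D i v))) (at z)" by simp
  moreover have "(\<Sum>i\<in>UNIV. axis i (D i (c *s v))) = c *s (\<Sum>i\<in>UNIV. axis i (D i v))" for c v
    by (simp add: vec_eq_iff axis_def if_distrib D cong: if_cong)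
  ultimately show thesis using that by blast
qed

text \<open>For properness, the preimage of a compact set under \<open>f \<circ> G\<close> is the preimage under \<open>G\<close> of a compact
  subset \<open>L\<close> of the open ball.  It is closed in the closed ball, and it stays away from the sphere, which
  \<open>G\<close> maps to the sphere.\<close>

lemma rational_proper_compose:
  fixes f :: "complex ^ 'n::finite \<Rightarrow> complex ^ 'm::finite" and G :: "complex ^ 'k::finite \<Rightarrow> complex ^ 'n"
  assumes f: "proper_holomorphic_ball_map f" and pq: "is_quotient_on_ball f p q"
    and poly: "\<And>i. polyfun (\<lambda>z. G z $ i)"
    and inside: "\<And>z. norm z < 1 \<Longrightarrow> norm (G z) < 1" and sphere: "\<And>z. norm z = 1 \<Longrightarrow> norm (G z) = 1"
  shows "rational_proper_ball_map (f \<circ> G)"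
proof -
  have f': "holomorphic_map_on f (ball 0 1)" "f ` ball 0 1 \<subseteq> ball 0 1"
    "\<And>K. compact K \<Longrightarrow> K \<subseteq> ball 0 1 \<Longrightarrow> compact {z \<in> ball 0 1. f z \<in> K}"
    using f unfolding proper_holomorphic_ball_map_iff by auto
  have cont: "continuous_on A G" for A
  proof (rule continuous_at_imp_continuous_on, rule ballI)
    fix z
    obtain D where "(G has_derivative D) (at z)" using polynomial_map_has_complex_derivative[OF poly] by blast
    then show "isCont G z" by (rule has_derivative_continuous)
  qed
  have "holomorphic_map_on (f \<circ> G) (ball 0 1)"
    unfolding holomorphic_map_on_def
  proof
    fix z :: "complex ^ 'k" assume z: "z \<in> ball 0 1"
    obtain D where D: "(G has_derivative D) (at z)" "\<And>c v. D (c *s v) = c *s D v"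
      using polynomial_map_has_complex_derivative[OF poly] by blast
    obtain E where E: "(f has_derivative E) (at (G z))" "\<And>c v. E (c *s v) = c *s E v"
    proof -
      have "G z \<in> ball 0 1" using inside[of z] z by simp
      then show ?thesis using f'(1) that unfolding holomorphic_map_on_def by blast
    qed
    show "\<exists>D. (f \<circ> G has_derivative D) (at z) \<and> (\<forall>c v. D (c *s v) = c *s D v)"
      using diff_chain_at[OF D(1) E(1)] D(2) E(2) by (intro exI[of _ "E \<circ> D"]) auto
  qed
  moreover have "(f \<circ> G) ` ball 0 1 \<subseteq> ball 0 1" using f'(2) inside by auto
  moreover have "compact {z \<in> ball 0 1. (f \<circ> G) z \<in> K}" if K: "compact K" "K \<subseteq> ball 0 1" for K
  proof -
    define L where "L = {w \<in> ball 0 1. f w \<in> K}"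
    have L: "compact L" unfolding L_def by (rule f'(3)[OF K])
    have "{z \<in> ball 0 1. (f \<circ> G) z \<in> K} = cball 0 1 \<inter> G -` L"
      using inside sphere by (auto simp: L_def order_le_less)
    moreover have "closed (cball 0 1 \<inter> G -` L)"
      by (intro continuous_closed_preimage cont compact_imp_closed[OF L]) simp
    moreover have "bounded (cball 0 1 \<inter> G -` L)" using bounded_Int bounded_cball by blast
    ultimately show ?thesis by (simp add: compact_eq_bounded_closed)
  qed
  ultimately have "proper_holomorphic_ball_map (f \<circ> G)"
    unfolding proper_holomorphic_ball_map_iff by blast
  moreover have "\<exists>P Q. is_quotient_on_ball (f \<circ> G) P Q"
  proof -
    have "\<exists>R. cpoly_eval R = (\<lambda>z. cpoly_eval r (G z))" for r :: "'n cpoly"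
      using polyfun_compose[OF polyfun_cpoly_eval[of r] poly] unfolding polyfun_def by (metis imageE)
    then obtain R where R: "\<And>r. cpoly_eval (R r) = (\<lambda>z. cpoly_eval r (G z))" by metis
    have "is_quotient_on_ball (f \<circ> G) (\<chi> j. R (p $ j)) (R q)"
      using pq inside by (auto simp: is_quotient_on_ball_def R cpoly_map_eval_def)
    then show ?thesis by blast
  qed
  ultimately show ?thesis by (simp add: rational_proper_ball_map_def)
qed

section \<open>Monomial maps between balls of maximal degree\<close>

text \<open>\<open>lucas m s\<close> is the coefficient of \<open>x\<^sup>m\<^sup>-\<^sup>2\<^sup>s y\<^sup>s\<close> in the power sum \<open>\<mu>\<^sup>m + \<nu>\<^sup>m\<close> of the roots
  \<open>\<mu>\<close>, \<open>\<nu>\<close> of \<open>u\<^sup>2 - x u - y\<close>; the recursion is that of the power sums.\<close>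

fun lucas :: "nat \<Rightarrow> nat \<Rightarrow> real" where
  "lucas 0 s = (if s = 0 then 2 else 0)"
| "lucas (Suc 0) s = (if s = 0 then 1 else 0)"
| "lucas (Suc (Suc m)) s = lucas (Suc m) s + (case s of 0 \<Rightarrow> 0 | Suc t \<Rightarrow> lucas m t)"

lemma lucas_nonneg: "lucas m s \<ge> 0"
  by (induction m s rule: lucas.induct) (auto split: nat.splits)

lemma lucas_pos: "2 * s \<le> m \<Longrightarrow> lucas m s > 0"
proof (induction m s rule: lucas.induct)
  case (3 m s)
  then show ?case using lucas_nonneg[of "Suc m" s] by (cases s) (auto intro: add_nonneg_pos)
qed auto

lemma lucas_zero: "m < 2 * s \<Longrightarrow> lucas m s = 0"
  by (induction m s rule: lucas.induct) (auto split: nat.splits)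

text \<open>On the line \<open>x + y = 1\<close> the roots are \<open>1\<close> and \<open>-y = x - 1\<close>.\<close>

lemma lucas_sum_eq:
  fixes x :: real
  shows "(\<Sum>s\<le>m. lucas m s * x ^ (m - 2 * s) * (1 - x) ^ s) = 1 + (x - 1) ^ m"
proof (induction m rule: less_induct)
  case (less m)
  consider "m = 0" | "m = 1" | k where "m = Suc (Suc k)" by (metis One_nat_def not0_implies_Suc)
  then show ?case
  proof cases
    case 3
    let ?t = "\<lambda>m s. lucas m s * x ^ (m - 2 * s) * (1 - x) ^ s"
    have *: "lucas (Suc k) s * x ^ (Suc (Suc k) - 2 * s) * (1 - x) ^ s = x * ?t (Suc k) s" for s
    proof (cases "2 * s \<le> Suc k")
      case True
      then have "Suc (Suc k) - 2 * s = Suc (Suc k - 2 * s)" by simp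
      then show ?thesis by simp
    next
      case False
      then show ?thesis by (simp add: lucas_zero)
    qed
    have "(\<Sum>s\<le>m. ?t m s) = (\<Sum>s\<le>Suc (Suc k). lucas (Suc k) s * x ^ (Suc (Suc k) - 2 * s) * (1 - x) ^ s)
      + (\<Sum>s\<le>Suc (Suc k). (case s of 0 \<Rightarrow> 0 | Suc t \<Rightarrow> lucas k t) * x ^ (Suc (Suc k) - 2 * s) * (1 - x) ^ s)"
      unfolding 3 by (simp only: lucas.simps distrib_right sum.distrib)
    also have "(\<Sum>s\<le>Suc (Suc k). lucas (Suc k) s * x ^ (Suc (Suc k) - 2 * s) * (1 - x) ^ s)
      = x * (\<Sum>s\<le>Suc k. ?t (Suc k) s)"
      unfolding * by (simp add: lucas_zero sum_distrib_left distrib_left)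
    also have "(\<Sum>s\<le>Suc (Suc k). (case s of 0 \<Rightarrow> 0 | Suc t \<Rightarrow> lucas k t) * x ^ (Suc (Suc k) - 2 * s) * (1 - x) ^ s)
      = (\<Sum>s\<le>Suc k. lucas k s * x ^ (k - 2 * s) * (1 - x) ^ Suc s)"
      by (subst sum.atMost_Suc_shift) simp
    also have "\<dots> = (1 - x) * (\<Sum>s\<le>k. ?t k s)"
      by (simp add: lucas_zero sum_distrib_left mult_ac)
    also have "x * (\<Sum>s\<le>Suc k. ?t (Suc k) s) = x * (1 + (x - 1) ^ Suc k)"
      using less.IH[of "Suc k"] 3 by simp
    also have "(1 - x) * (\<Sum>s\<le>k. ?t k s) = (1 - x) * (1 + (x - 1) ^ k)"
      using less.IH[of k] 3 by simp
    finally show ?thesis by (simp add: 3 algebra_simps)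
  qed auto
qed

text \<open>With \<open>CARD('n) = r + 2\<close>, the \<open>r + 1\<close> monomials of the Lucas polynomial of index \<open>2 r + 1\<close>
  together with \<open>y\<^sup>2\<^sup>r\<^sup>+\<^sup>1\<close> use each index once.  The index \<open>i0\<close> carries the last monomial.\<close>

lemma ex_monomial_sphere_identity:
  assumes "CARD('n::finite) \<ge> 2"
  obtains \<kappa> :: "'n::finite \<Rightarrow> real" and \<alpha> \<beta> :: "'n::finite \<Rightarrow> nat" and i0 :: "'n::finite"
  where "\<And>i. \<kappa> i > 0" "\<And>i. 1 \<le> \<alpha> i + \<beta> i" "\<And>i. \<alpha> i + \<beta> i \<le> 2 * CARD('n) - 3"
    "\<alpha> i0 + \<beta> i0 = 2 * CARD('n) - 3"
    "\<And>x y. x + y = 1 \<Longrightarrow> (\<Sum>i\<in>UNIV. (\<kappa> i)\<^sup>2 * x ^ \<alpha> i * y ^ \<beta> i) = 1"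
proof -
  define r where "r = CARD('n) - 2"
  have card: "CARD('n) = r + 2" using assms by (simp add: r_def)
  obtain h :: "'n \<Rightarrow> nat" where h: "bij_betw h UNIV {0..<r + 2}"
    using ex_bij_betw_finite_nat[of "UNIV :: 'n set"] card by auto
  define \<kappa> where "\<kappa> = (\<lambda>i. if h i \<le> r then sqrt (lucas (2 * r + 1) (h i)) else 1)"
  define \<alpha> where "\<alpha> = (\<lambda>i. if h i \<le> r then 2 * r + 1 - 2 * h i else 0)"
  define \<beta> where "\<beta> = (\<lambda>i. if h i \<le> r then h i else 2 * r + 1)"
  have "r + 1 \<in> h ` UNIV" using h by (simp add: bij_betw_def)
  then obtain i0 where i0: "h i0 = r + 1" by (metis imageE)
  show thesis
  proof
    show "\<kappa> i > 0" for i using lucas_pos[of "h i" "2 * r + 1"] by (simp add: \<kappa>_def)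
    show "1 \<le> \<alpha> i + \<beta> i" "\<alpha> i + \<beta> i \<le> 2 * CARD('n) - 3" for i
      by (auto simp: \<alpha>_def \<beta>_def card)
    show "\<alpha> i0 + \<beta> i0 = 2 * CARD('n) - 3" by (simp add: \<alpha>_def \<beta>_def card i0)
    fix x y :: real assume "x + y = 1"
    then have y: "y = 1 - x" by simp
    let ?t = "\<lambda>k. if k \<le> r then lucas (2 * r + 1) k * x ^ (2 * r + 1 - 2 * k) * y ^ k else y ^ (2 * r + 1)"
    have "(\<Sum>i\<in>UNIV. (\<kappa> i)\<^sup>2 * x ^ \<alpha> i * y ^ \<beta> i) = (\<Sum>i\<in>UNIV. ?t (h i))"
      by (intro sum.cong) (auto simp: \<kappa>_def \<alpha>_def \<beta>_def lucas_nonneg)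
    also have "\<dots> = (\<Sum>k\<in>{0..<r + 2}. ?t k)"
      by (rule sum.reindex_bij_betw[OF h])
    also have "{0..<r + 2} = insert (r + 1) {..r}" by auto
    also have "(\<Sum>k\<in>insert (r + 1) {..r}. ?t k)
      = y ^ (2 * r + 1) + (\<Sum>k\<le>r. lucas (2 * r + 1) k * x ^ (2 * r + 1 - 2 * k) * y ^ k)"
      by simp
    also have "(\<Sum>k\<le>r. lucas (2 * r + 1) k * x ^ (2 * r + 1 - 2 * k) * y ^ k)
      = (\<Sum>k\<le>2 * r + 1. lucas (2 * r + 1) k * x ^ (2 * r + 1 - 2 * k) * y ^ k)"
      by (rule sum.mono_neutral_left) (auto simp: lucas_zero)
    also have "\<dots> = 1 - y ^ (2 * r + 1)"
    proof -
      have "(x - 1) ^ (2 * r + 1) = (- y) ^ (2 * r + 1)" using y by simp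
      also have "\<dots> = - (y ^ (2 * r + 1))" by (rule power_minus_odd) simp
      finally show ?thesis using lucas_sum_eq[of "2 * r + 1" x, folded y] by simp
    qed
    finally show "(\<Sum>i\<in>UNIV. (\<kappa> i)\<^sup>2 * x ^ \<alpha> i * y ^ \<beta> i) = 1" by simp
  qed
qed

text \<open>Scaling by \<open>s = x + y < 1\<close> from the line, where the sum is \<open>1\<close>, multiplies each term by at most
  \<open>s\<close>, because every monomial has positive degree.\<close>

lemma monomial_sum_less_1:
  fixes \<kappa> :: "'n::finite \<Rightarrow> real"
  assumes id: "\<And>x y. x + y = 1 \<Longrightarrow> (\<Sum>i\<in>UNIV. (\<kappa> i)\<^sup>2 * x ^ \<alpha> i * y ^ \<beta> i) = 1"
    and pos: "\<And>i. 1 \<le> \<alpha> i + \<beta> i" and xy: "x \<ge> 0" "y \<ge> 0" "x + y < 1"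
  shows "(\<Sum>i\<in>UNIV. (\<kappa> i)\<^sup>2 * x ^ \<alpha> i * y ^ \<beta> i) < 1"
proof (cases "x + y = 0")
  case True
  then have "x = 0" "y = 0" using xy by auto
  then have "(\<kappa> i)\<^sup>2 * x ^ \<alpha> i * y ^ \<beta> i = 0" for i
    using pos[of i] by (cases "\<alpha> i = 0") auto
  then show ?thesis by (simp only: sum.neutral_const zero_less_one)
next
  case False
  define s where "s = x + y"
  have s: "0 < s" "s < 1" using False xy by (auto simp: s_def)
  have le: "(\<kappa> i)\<^sup>2 * x ^ \<alpha> i * y ^ \<beta> i \<le> s * ((\<kappa> i)\<^sup>2 * (x / s) ^ \<alpha> i * (y / s) ^ \<beta> i)" for i
  proof -
    have "(\<kappa> i)\<^sup>2 * x ^ \<alpha> i * y ^ \<beta> i = s ^ (\<alpha> i + \<beta> i) * ((\<kappa> i)\<^sup>2 * (x / s) ^ \<alpha> i * (y / s) ^ \<beta> i)"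
      using s by (simp add: power_divide power_add)
    also have "\<dots> \<le> s * ((\<kappa> i)\<^sup>2 * (x / s) ^ \<alpha> i * (y / s) ^ \<beta> i)"
      using s xy power_decreasing[of 1 "\<alpha> i + \<beta> i" s] pos[of i] by (intro mult_right_mono) auto
    finally show ?thesis .
  qed
  have "(\<Sum>i\<in>UNIV. (\<kappa> i)\<^sup>2 * x ^ \<alpha> i * y ^ \<beta> i) \<le>
      s * (\<Sum>i\<in>UNIV. (\<kappa> i)\<^sup>2 * (x / s) ^ \<alpha> i * (y / s) ^ \<beta> i)"
    unfolding sum_distrib_left by (intro sum_mono le)
  also have "\<dots> = s"
    using s by (subst id) (auto simp: s_def add_divide_distrib[symmetric])
  finally show ?thesis using s by simp
qed

section \<open>Unitary maps\<close>

lemma norm_vec_square: "(norm (x :: complex ^ 'n::finite))\<^sup>2 = (\<Sum>i\<in>UNIV. (cmod (x $ i))\<^sup>2)"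
  by (simp add: norm_vec_def L2_set_def sum_nonneg)

definition herm :: "complex ^ 'n::finite \<Rightarrow> complex ^ 'n \<Rightarrow> complex" where
  "herm x y = (\<Sum>i\<in>UNIV. x $ i * cnj (y $ i))"

lemma herm_self: "herm x x = of_real ((norm x)\<^sup>2)"
  by (simp add: herm_def norm_vec_square flip: complex_norm_square)

lemma herm_diff_left: "herm (x - y) z = herm x z - herm y z"
  and herm_diff_right: "herm z (x - y) = herm z x - herm z y"
  and herm_scale_left: "herm (c *s x) z = c * herm x z"
  and herm_scale_right: "herm z (c *s x) = cnj c * herm z x"
  by (simp_all add: herm_def algebra_simps sum_subtractf sum_distrib_left)

lemma herm_commute: "herm y x = cnj (herm x y)"
  by (simp add: herm_def mult.commute)

text \<open>A Householder reflection.  In the complex case it exchanges two unit vectors \<open>e\<close> and \<open>u\<close> only if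
  their Hermitian product is real, so the phase of \<open>u\<close> is adjusted by \<open>c\<close>.\<close>

lemma ex_unitary:
  fixes v :: "complex ^ 'n::finite"
  assumes "v \<noteq> 0"
  obtains A :: "complex ^ 'n ^ 'n" and c
  where "\<And>x. norm (A *v x) = norm x" "A *v axis i 1 = c *s v" "c \<noteq> 0"
proof -
  define e :: "complex ^ 'n" where "e = axis i 1"
  define c where "c = (if v $ i = 0 then 1 else cnj (v $ i) / cmod (v $ i)) / norm v"
  define u where "u = c *s v"
  have nv: "norm v \<noteq> 0" using assms by simp
  have c0: "c \<noteq> 0" using nv by (simp add: c_def)
  have "cmod c = 1 / norm v" by (simp add: c_def norm_divide)
  have "norm u = cmod c * norm v"
  proof -
    have "herm u u = c * cnj c * herm v v" by (simp add: u_def herm_scale_left herm_scale_right)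
    then have "of_real ((norm u)\<^sup>2) = (of_real ((cmod c)\<^sup>2 * (norm v)\<^sup>2) :: complex)"
      by (simp add: herm_self flip: complex_norm_square)
    then have "(norm u)\<^sup>2 = (cmod c * norm v)\<^sup>2"
      unfolding of_real_eq_iff by (simp add: power_mult_distrib)
    then show ?thesis by (simp add: power2_eq_iff_nonneg)
  qed
  then have "norm u = 1" using nv \<open>cmod c = 1 / norm v\<close> by simp
  then have uu: "herm u u = 1" by (simp add: herm_self)
  have ee: "herm e e = 1" by (simp add: herm_def e_def axis_def if_distrib cong: if_cong)
  have eu: "herm e u = cnj (u $ i)"
    by (simp add: herm_def e_def axis_def if_distrib if_distribR cong: if_cong)
  have real: "cnj (u $ i) = u $ i"
  proof -
    have "cnj (v $ i) * v $ i = of_real ((cmod (v $ i))\<^sup>2)" by (simp add: mult.commute flip: complex_norm_square)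
    then have "u $ i = of_real (if v $ i = 0 then 0 else (cmod (v $ i))\<^sup>2 / cmod (v $ i) / norm v)"
      by (simp add: u_def c_def)
    then show ?thesis by (metis complex_cnj_complex_of_real)
  qed
  define w where "w = e - u"
  \<comment> \<open>if \<open>w = 0\<close>, then \<open>W = 0\<close>, and division by zero makes \<open>A\<close> the identity, as it should be\<close>
  define W where "W = herm w w"
  define A :: "complex ^ 'n ^ 'n"
    where "A = (\<chi> k l. (if k = l then 1 else 0) - 2 / W * w $ k * cnj (w $ l))"
  have A: "A *v x = x - (2 * herm x w / W) *s w" for x
  proof -
    have "(\<Sum>l\<in>UNIV. ((if k = l then 1 else 0) - 2 / W * w $ k * cnj (w $ l)) * x $ l)
      = x $ k - 2 * herm x w / W * w $ k" for k
    proof -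
      have "(\<Sum>l\<in>UNIV. ((if k = l then 1 else 0) - 2 / W * w $ k * cnj (w $ l)) * x $ l) =
        (\<Sum>l\<in>UNIV. (if k = l then x $ l else 0) - 2 / W * w $ k * (x $ l * cnj (w $ l)))"
        by (intro sum.cong) (simp_all add: left_diff_distrib)
      also have "\<dots> = x $ k - 2 / W * w $ k * herm x w"
        unfolding herm_def sum_subtractf sum_distrib_left[symmetric] by simp
      finally show ?thesis by simp
    qed
    then show ?thesis by (simp add: A_def matrix_vector_mult_def vec_eq_iff)
  qed
  have W_real: "cnj W = W" using herm_commute[of w w] by (simp add: W_def)
  have "herm (A *v x) (A *v x) = herm x x" for x
  proof -
    define a where "a = herm x w"
    have "herm w x = cnj a" by (simp add: a_def herm_commute[of w x])
    then have "herm (A *v x) (A *v x) =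
      herm x x - cnj (2 * a / W) * a - (2 * a / W) * cnj a + (2 * a / W) * cnj (2 * a / W) * W"
      by (simp add: A herm_diff_left herm_diff_right herm_scale_left herm_scale_right W_def a_def algebra_simps)
    also have "\<dots> = herm x x" by (cases "W = 0") (simp_all add: W_real field_simps)
    finally show ?thesis .
  qed
  then have "(norm (A *v x))\<^sup>2 = (norm x)\<^sup>2" for x unfolding herm_self of_real_eq_iff .
  then have norm: "norm (A *v x) = norm x" for x by (simp add: power2_eq_iff_nonneg)
  have "A *v e = u"
  proof (cases "W = 0")
    case True
    then have "w = 0" by (simp add: W_def herm_self)
    then show ?thesis using A[of e] by (simp add: w_def)
  next
    case False
    have "herm e w = 1 - u $ i" by (simp add: w_def herm_diff_right ee eu real)
    moreover have "W = 2 * (1 - u $ i)"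
      using herm_commute[of u e]
      by (simp add: W_def w_def herm_diff_left herm_diff_right ee uu eu real)
    ultimately have "2 * herm e w / W = 1" using False by auto
    then show ?thesis using A[of e] by (simp add: w_def)
  qed
  then have "A *v axis i 1 = c *s v" unfolding e_def u_def .
  then show thesis by (rule that[OF norm _ c0])
qed

lemma infinite_circle:
  assumes "r > 0"
  shows "infinite {z. cmod z = r}"
proof
  assume "finite {z. cmod z = r}"
  then have "finite (Re ` {z. cmod z = r})" by simp
  moreover have "{0..r} \<subseteq> Re ` {z. cmod z = r}"
  proof
    fix t assume t: "t \<in> {0..r}"
    then have "t\<^sup>2 \<le> r\<^sup>2" by (intro power_mono) auto
    then have "cmod (Complex t (sqrt (r\<^sup>2 - t\<^sup>2))) = r" using assms by (simp add: cmod_def)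
    then show "t \<in> Re ` {z. cmod z = r}" by (intro image_eqI[of _ _ "Complex t (sqrt (r\<^sup>2 - t\<^sup>2))"]) auto
  qed
  ultimately have "finite {0..r}" using finite_subset by blast
  then show False using infinite_Icc[OF assms] by blast
qed

lemma surj_norm_preserving_matrix:
  fixes A :: "complex ^ 'n::finite ^ 'n"
  assumes "\<And>x. norm (A *v x) = norm x"
  shows "\<exists>x. A *v x = y"
proof -
  have "linear ((*v) A)"
  proof (rule linearI)
    show "A *v (x + y) = A *v x + A *v y" for x y by (rule matrix_vector_right_distrib)
    have "r *\<^sub>R x = of_real r *s x" for r and x :: "complex ^ 'n"
      by (simp add: vec_eq_iff) (simp add: scaleR_conv_of_real)
    then show "A *v (r *\<^sub>R x) = r *\<^sub>R (A *v x)" for r x by (simp add: vector_scalar_commute)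
  qed
  moreover have "inj ((*v) A)"
  proof (rule injI)
    fix x y assume "A *v x = A *v y"
    then have "A *v (x - y) = 0" by (simp add: matrix_vector_mult_diff_distrib)
    then have "norm (x - y) = 0" using assms[of "x - y"] by simp
    then show "x = y" by simp
  qed
  ultimately have "surj ((*v) A)" by (rule linear_inj_imp_surj)
  then show ?thesis by (metis surjD)
qed

section \<open>The generic curve and the degree of the composite\<close>

lemma finite_zeros_along:
  fixes P :: "'n::finite cpoly"
  assumes "top_form P v \<noteq> 0"
  shows "finite {s. cpoly_eval P (x + s *s v) = 0}"
proof -
  have line: "(\<chi> i. poly [:x $ i, v $ i:] s) = x + s *s v" "(\<chi> i. coeff [:x $ i, v $ i:] 1) = v" for s
    by (simp_all add: vec_eq_iff)
  obtain F where "\<And>s. poly F s = cpoly_eval P (\<chi> i. poly [:x $ i, v $ i:] s)"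
    "degree F \<le> cpoly_degree P * 1"
    "coeff F (cpoly_degree P * 1) = top_form P (\<chi> i. coeff [:x $ i, v $ i:] 1)"
    by (rule restrict_to_curve[where G = "\<lambda>i. [:x $ i, v $ i:]" and D = 1 and P = P]) auto
  then have F: "\<And>s. poly F s = cpoly_eval P (x + s *s v)" "coeff F (cpoly_degree P * 1) = top_form P v"
    unfolding line by blast+
  then have "F \<noteq> 0" using assms by auto
  then show ?thesis using poly_roots_finite[of F] by (simp add: F(1))
qed

text \<open>By homogeneity, \<open>top_form P (x + s v)\<close> vanishes for \<open>s \<noteq> 0\<close> iff \<open>top_form P (v + x / s)\<close> does, and the
  latter is a polynomial in \<open>1 / s\<close> with nonzero constant term.\<close>

lemma finite_zeros_top_form:
  fixes P :: "'n::finite cpoly"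
  assumes "top_form P v \<noteq> 0"
  shows "finite {s. top_form P (x + s *s v) = 0}"
proof -
  obtain F where F: "\<And>t. poly F t = top_form P (v + t *s x)"
    using polyfun_line[OF polyfun_top_form] by blast
  then have "poly F 0 \<noteq> 0" using assms by simp
  then have "F \<noteq> 0" by auto
  then have fin: "finite {t. poly F t = 0}" by (rule poly_roots_finite)
  have "{s. top_form P (x + s *s v) = 0} \<subseteq> insert 0 (inverse ` {t. poly F t = 0})"
  proof
    fix s assume s: "s \<in> {s. top_form P (x + s *s v) = 0}"
    show "s \<in> insert 0 (inverse ` {t. poly F t = 0})"
    proof (cases "s = 0")
      case False
      have eq: "x + s *s v = s *s (v + inverse s *s x)"
        using False by (simp add: vec_eq_iff field_simps)
      have "top_form P (x + s *s v) = s ^ cpoly_degree P * top_form P (v + inverse s *s x)"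
        by (subst eq) (rule top_form_scale)
      then have "top_form P (v + inverse s *s x) = 0" using s False by simp
      then have "inverse s \<in> {t. poly F t = 0}" by (simp add: F)
      then show ?thesis by (metis image_eqI inverse_inverse_eq insertI2)
    qed simp
  qed
  then show ?thesis using fin finite_subset by blast
qed

lemma cpoly_degree_le_map_degree: "cpoly_degree (p $ j) \<le> cpoly_map_degree p"
  unfolding cpoly_map_degree_def by (intro Max_ge) auto

lemma ex_component_of_degree:
  fixes p :: "('n::finite cpoly) ^ 'm::finite"
  assumes "q \<noteq> 0"
  obtains F where "F = q \<or> (\<exists>j. F = p $ j)" "F \<noteq> 0"
    "cpoly_degree F = max (cpoly_map_degree p) (cpoly_degree q)"
proof (cases "cpoly_map_degree p \<le> cpoly_degree q")
  case True
  then show thesis using that[of q] assms by simp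
next
  case False
  have "cpoly_map_degree p \<in> range (\<lambda>j. cpoly_degree (p $ j))"
    unfolding cpoly_map_degree_def by (intro Max_in) auto
  then obtain j where j: "cpoly_degree (p $ j) = cpoly_map_degree p" by auto
  have "p $ j \<noteq> 0" using False j by (auto simp: cpoly_degree_def)
  then show thesis using that[of "p $ j"] j False by auto
qed

text \<open>The unitary matrix sends the basis vector \<open>i0\<close> to a direction \<open>v\<close> in which the top forms of
  \<open>q\<close> and \<open>F\<close> do not vanish.  Changing the phase \<open>\<tau>\<close> of the component \<open>i0\<close> moves each point of
  the curve along the line in the direction \<open>v\<close>.  The remaining phases are fixed first, so that the
  lines through the curve avoid the common zeros except for finitely many parameters \<open>Z\<close>; for
  those, all but finitely many \<open>\<tau>\<close> make \<open>q\<close> nonzero.  The parameter \<open>0\<close> cannot be moved, but there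
  the curve passes through the origin, where \<open>q\<close> does not vanish.\<close>

lemma ex_generic_curve:
  fixes p :: "('n::finite cpoly) ^ 'm::finite" and q :: "'n cpoly" and \<kappa> :: "'n \<Rightarrow> real" and k :: "'n \<Rightarrow> nat"
  assumes low: "lowest_terms p q" and q0: "cpoly_eval q 0 \<noteq> 0" and "F \<noteq> 0"
    and \<kappa>: "\<And>i. \<kappa> i > 0" and k: "\<And>i. 1 \<le> k i" "\<And>i. k i \<le> D" "k i0 = D"
  obtains A :: "complex ^ 'n ^ 'n" and \<zeta> :: "'n \<Rightarrow> complex"
  where "\<And>x. norm (A *v x) = norm x" "\<And>i. cmod (\<zeta> i) = \<kappa> i"
    "top_form F (A *v (\<chi> i. coeff (monom (\<zeta> i) (k i)) D)) \<noteq> 0"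
    "\<And>t. cpoly_eval q (A *v (\<chi> i. \<zeta> i * t ^ k i)) = 0 \<Longrightarrow>
       \<exists>j. cpoly_eval (p $ j) (A *v (\<chi> i. \<zeta> i * t ^ k i)) \<noteq> 0"
proof -
  have D: "D \<ge> 1" using k(1)[of i0] k(3) by simp
  have "q \<noteq> 0" using q0 by auto
  then obtain x1 x2 where "top_form q x1 \<noteq> 0" "top_form F x2 \<noteq> 0"
    using top_form_nonzero \<open>F \<noteq> 0\<close> by blast
  then obtain x3 where x3: "top_form q x3 * top_form F x3 \<noteq> 0"
    using polyfun_nonzero_both[OF polyfun_top_form polyfun_top_form, of q x1 F x2] by auto
  \<comment> \<open>the extra coordinate factor ensures that the direction is not zero\<close>
  have "polyfun (\<lambda>z. top_form q z * top_form F z)" by (intro polyfun_mult polyfun_top_form)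
  moreover have "polyfun (\<lambda>z :: complex ^ 'n. z $ i0)" by (rule polyfun_coord)
  moreover have "(axis i0 1 :: complex ^ 'n) $ i0 \<noteq> 0" by simp
  ultimately obtain v0 where v0: "top_form q v0 * top_form F v0 \<noteq> 0" "v0 $ i0 \<noteq> 0"
    using polyfun_nonzero_both[of "\<lambda>z. top_form q z * top_form F z" "\<lambda>z. z $ i0" x3 "axis i0 1"] x3 by blast
  have "v0 \<noteq> 0" using v0(2) by auto
  then obtain A :: "complex ^ 'n ^ 'n" and c
    where A: "\<And>x. norm (A *v x) = norm x" "A *v axis i0 1 = c *s v0" "c \<noteq> 0"
    using ex_unitary[of v0 i0] by blast
  define v where "v = A *v axis i0 1"
  have v: "top_form q v \<noteq> 0" "top_form F v \<noteq> 0"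
    using v0(1) A(3) by (auto simp: v_def A(2) top_form_scale)
  have A_add: "A *v (x + s *s axis i0 1) = A *v x + s *s v" for x s
    by (simp add: matrix_vector_right_distrib vector_scalar_commute v_def)
  obtain E x0 where E: "polyfun E" "E x0 \<noteq> 0"
    "\<And>x t. E x \<noteq> 0 \<Longrightarrow> cpoly_eval q (x + t *s v) = 0 \<Longrightarrow> \<exists>j. cpoly_eval (p $ j) (x + t *s v) \<noteq> 0"
    using generic_lines_avoid_common_zeros[OF low v(1)] by blast
  have Apoly: "polyfun (\<lambda>x. (A *v x) $ i)" for i
    unfolding matrix_vector_mult_def
    by (auto intro!: polyfun_sum polyfun_mult)
  have EA: "polyfun (\<lambda>x. E (A *v x))" by (rule polyfun_compose[OF E(1) Apoly])
  obtain \<xi>0 where "A *v \<xi>0 = x0" using surj_norm_preserving_matrix[OF A(1)] by blast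
  then have "E (A *v \<xi>0) \<noteq> 0" using E(2) by simp
  then obtain \<xi> where \<xi>: "\<And>i. \<xi> $ i \<in> {z. cmod z = \<kappa> i}" "E (A *v \<xi>) \<noteq> 0"
    using polyfun_nonzero_on_product[OF EA, of \<xi>0 "\<lambda>i. {z. cmod z = \<kappa> i}"] infinite_circle[OF \<kappa>] by blast
  \<comment> \<open>the component \<open>i0\<close> is held at \<open>\<xi> $ i0\<close>, so that \<open>y 1 = \<xi>\<close>, a point where \<open>E (A *v _)\<close> is nonzero\<close>
  define y where "y = (\<lambda>t. \<chi> i. if i = i0 then \<xi> $ i0 else \<xi> $ i * t ^ k i)"
  define a where "a = (\<chi> i. if i = i0 then 0 else coeff (monom (\<xi> $ i) (k i)) D)"
  define \<zeta> where "\<zeta> = (\<lambda>\<tau> i. if i = i0 then \<tau> else \<xi> $ i)"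
  have curve: "A *v (\<chi> i. \<zeta> \<tau> i * t ^ k i) = A *v y t + (\<tau> * t ^ D - \<xi> $ i0) *s v" for \<tau> t
  proof -
    have "(\<chi> i. \<zeta> \<tau> i * t ^ k i) = y t + (\<tau> * t ^ D - \<xi> $ i0) *s axis i0 1"
      by (simp add: vec_eq_iff y_def \<zeta>_def axis_def k(3))
    then show ?thesis by (simp only: A_add)
  qed
  have top: "A *v (\<chi> i. coeff (monom (\<zeta> \<tau> i) (k i)) D) = A *v a + \<tau> *s v" for \<tau>
  proof -
    have "(\<chi> i. coeff (monom (\<zeta> \<tau> i) (k i)) D) = a + \<tau> *s axis i0 1"
      by (simp add: vec_eq_iff a_def \<zeta>_def axis_def k(3))
    then show ?thesis by (simp only: A_add)
  qed
  define Z where "Z = {t. E (A *v y t) = 0}"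
  have "finite Z"
  proof -
    obtain P where P: "cpoly_eval P = (\<lambda>x. E (A *v x))" using EA by (auto simp: polyfun_def)
    obtain H where H: "\<And>t. poly H t = cpoly_eval P
        (\<chi> i. poly (if i = i0 then [:\<xi> $ i0:] else monom (\<xi> $ i) (k i)) t)"
      by (rule restrict_to_curve[where D = D and P = P and
        G = "\<lambda>i. if i = i0 then [:\<xi> $ i0:] else monom (\<xi> $ i) (k i)"])
        (use k D in \<open>auto intro: order.trans[OF degree_monom_le]\<close>)
    have "(\<chi> i. poly (if i = i0 then [:\<xi> $ i0:] else monom (\<xi> $ i) (k i)) t) = y t" for t
      by (simp add: y_def vec_eq_iff poly_monom)
    then have H': "poly H t = E (A *v y t)" for t by (simp add: H P)
    have "y 1 = \<xi>" by (simp add: y_def vec_eq_iff)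
    then have "poly H 1 \<noteq> 0" using \<xi>(2) H' by simp
    then have "H \<noteq> 0" by auto
    then show ?thesis using poly_roots_finite[of H] by (simp add: Z_def H')
  qed
  define B where "B = {\<tau>. top_form F (A *v a + \<tau> *s v) = 0} \<union>
    (\<Union>t\<in>Z - {0}. {\<tau>. cpoly_eval q (A *v (\<chi> i. \<zeta> \<tau> i * t ^ k i)) = 0})"
  have "finite B"
    unfolding B_def
  proof (intro finite_UnI finite_UN_I)
    show "finite {\<tau>. top_form F (A *v a + \<tau> *s v) = 0}" by (rule finite_zeros_top_form[OF v(2)])
    show "finite (Z - {0})" using \<open>finite Z\<close> by simp
    fix t assume t: "t \<in> Z - {0}"
    have "inj (\<lambda>\<tau>. \<tau> * t ^ D - \<xi> $ i0)" using t by (auto simp: inj_on_def)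
    then have "finite ((\<lambda>\<tau>. \<tau> * t ^ D - \<xi> $ i0) -` {s. cpoly_eval q (A *v y t + s *s v) = 0})"
      using finite_zeros_along[OF v(1)] by (rule finite_vimageI[rotated])
    then show "finite {\<tau>. cpoly_eval q (A *v (\<chi> i. \<zeta> \<tau> i * t ^ k i)) = 0}"
      by (simp add: curve vimage_def)
  qed
  then have "\<not> {z. cmod z = \<kappa> i0} \<subseteq> B"
    using infinite_circle[OF \<kappa>[of i0]] by (auto dest: finite_subset)
  then obtain \<tau> where \<tau>: "cmod \<tau> = \<kappa> i0" "\<tau> \<notin> B" by auto
  show thesis
  proof
    show "norm (A *v x) = norm x" for x by (rule A(1))
    show "cmod (\<zeta> \<tau> i) = \<kappa> i" for i using \<tau>(1) \<xi>(1)[of i] by (simp add: \<zeta>_def)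
    show "top_form F (A *v (\<chi> i. coeff (monom (\<zeta> \<tau> i) (k i)) D)) \<noteq> 0"
      using \<tau>(2) unfolding top B_def by blast
    fix t assume zero: "cpoly_eval q (A *v (\<chi> i. \<zeta> \<tau> i * t ^ k i)) = 0"
    have "t \<noteq> 0"
    proof
      assume "t = 0"
      moreover have "(0 :: complex) ^ k i = 0" for i using k(1)[of i] by simp
      ultimately have "(\<chi> i. \<zeta> \<tau> i * t ^ k i) = 0" by (simp add: vec_eq_iff)
      then show False using zero q0 by simp
    qed
    then have "t \<notin> Z" using zero \<tau>(2) by (auto simp: B_def)
    then have "E (A *v y t) \<noteq> 0" by (simp add: Z_def)
    from E(3)[OF this] zero show "\<exists>j. cpoly_eval (p $ j) (A *v (\<chi> i. \<zeta> \<tau> i * t ^ k i)) \<noteq> 0"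
      unfolding curve by blast
  qed
qed

text \<open>Along the line \<open>t v\<close> both \<open>P/Q\<close> and the pullback of \<open>p/q\<close> represent the same function.  The second
  fraction is reduced, so numerators and denominator of the first are its multiples by one polynomial
  \<open>u\<close>, and their degrees are at least \<open>cpoly_degree F * D\<close>.\<close>

lemma degree_times_le_composite_degree:
  fixes f :: "complex ^ 'n::finite \<Rightarrow> complex ^ 'm::finite" and G :: "complex ^ 'k::finite \<Rightarrow> complex ^ 'n"
  assumes pq: "is_quotient_on_ball f p q" and PQ: "is_quotient_on_ball (f \<circ> G) P Q"
    and inside: "\<And>z. norm z < 1 \<Longrightarrow> norm (G z) < 1"
    and curve: "\<And>i t. poly (g i) t = G (t *s v) $ i" and deg: "\<And>i. degree (g i) \<le> D" and "D > 0"
    and coprime: "\<And>t. cpoly_eval q (G (t *s v)) = 0 \<Longrightarrow> \<exists>j. cpoly_eval (p $ j) (G (t *s v)) \<noteq> 0"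
    and F: "F = q \<or> (\<exists>j. F = p $ j)" "top_form F (\<chi> i. coeff (g i) D) \<noteq> 0"
  shows "cpoly_degree F * D \<le> max (cpoly_map_degree P) (cpoly_degree Q)"
proof -
  have "\<exists>S. (\<forall>t. poly S t = cpoly_eval R (G (t *s v))) \<and>
     coeff S (cpoly_degree R * D) = top_form R (\<chi> i. coeff (g i) D)" for R
  proof -
    obtain S where "\<And>t. poly S t = cpoly_eval R (\<chi> i. poly (g i) t)"
      "coeff S (cpoly_degree R * D) = top_form R (\<chi> i. coeff (g i) D)"
      using restrict_to_curve[of g D R] deg \<open>D > 0\<close> by metis
    moreover have "(\<chi> i. poly (g i) t) = G (t *s v)" for t by (simp add: vec_eq_iff curve)
    ultimately show ?thesis by auto
  qed
  then obtain S where S: "\<And>R t. poly (S R) t = cpoly_eval R (G (t *s v))"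
    "\<And>R. coeff (S R) (cpoly_degree R * D) = top_form R (\<chi> i. coeff (g i) D)" by metis
  have "\<exists>T. (\<forall>t. poly T t = cpoly_eval R (t *s v)) \<and> degree T \<le> cpoly_degree R" for R :: "'k cpoly"
  proof -
    have line: "(\<chi> i. poly [:0, v $ i:] t) = t *s v" for t by (simp add: vec_eq_iff)
    obtain T where "\<And>t. poly T t = cpoly_eval R (\<chi> i. poly [:0, v $ i:] t)"
      "degree T \<le> cpoly_degree R * 1"
      by (rule restrict_to_curve[where G = "\<lambda>i. [:0, v $ i:]" and D = 1 and P = R]) auto
    then show ?thesis unfolding line mult_1_right by blast
  qed
  then obtain T where T: "\<And>R t. poly (T R) t = cpoly_eval R (t *s v)" "\<And>R. degree (T R) \<le> cpoly_degree R"
    by metis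
  have cross: "S (p $ j) * T Q = S q * T (P $ j)" for j
  proof -
    \<comment> \<open>for \<open>t\<close> in this disc the point \<open>t v\<close> lies in the unit ball; adding \<open>1\<close> covers the case \<open>v = 0\<close>\<close>
    define r where "r = 1 / (norm v + 1)"
    have r: "r > 0" by (simp add: r_def add_nonneg_pos)
    have "poly (S (p $ j) * T Q - S q * T (P $ j)) t = 0" if t: "t \<in> ball 0 r" for t
    proof -
      have "(norm (t *s v))\<^sup>2 = (cmod t * norm v)\<^sup>2"
        by (simp add: norm_vec_square norm_mult power_mult_distrib sum_distrib_left)
      then have "norm (t *s v) = cmod t * norm v" by (simp add: power2_eq_iff_nonneg)
      also have "\<dots> \<le> cmod t * (norm v + 1)" by (intro mult_left_mono) auto
      also have "\<dots> < 1" using t pos_less_divide_eq[of "norm v + 1" "cmod t" 1]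
        by (simp add: r_def add_nonneg_pos)
      finally have n: "norm (t *s v) < 1" .
      then have "norm (G (t *s v)) < 1" by (rule inside)
      then have 1: "cpoly_eval q (G (t *s v)) \<noteq> 0"
        "f (G (t *s v)) = inverse (cpoly_eval q (G (t *s v))) *s cpoly_map_eval p (G (t *s v))"
        using pq by (auto simp: is_quotient_on_ball_def)
      have 2: "cpoly_eval Q (t *s v) \<noteq> 0"
        "f (G (t *s v)) = inverse (cpoly_eval Q (t *s v)) *s cpoly_map_eval P (t *s v)"
        using PQ n by (auto simp: is_quotient_on_ball_def)
      have "inverse (cpoly_eval q (G (t *s v))) * cpoly_eval (p $ j) (G (t *s v)) =
        inverse (cpoly_eval Q (t *s v)) * cpoly_eval (P $ j) (t *s v)"
        using arg_cong[OF 1(2)[unfolded 2(2)], of "\<lambda>x. x $ j"] by (simp add: cpoly_map_eval_def)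
      then show ?thesis using 1(1) 2(1) by (simp add: S T field_simps)
    qed
    then have "ball 0 r \<subseteq> {t. poly (S (p $ j) * T Q - S q * T (P $ j)) t = 0}" by blast
    moreover have "infinite (ball (0 :: complex) r)"
      using finite_imp_not_open[of "ball (0 :: complex) r"] r by auto
    ultimately have "infinite {t. poly (S (p $ j) * T Q - S q * T (P $ j)) t = 0}"
      using finite_subset by blast
    then have "S (p $ j) * T Q - S q * T (P $ j) = 0" using poly_roots_finite by blast
    then show ?thesis by simp
  qed
  have "norm (G (0 *s v)) < 1" by (rule inside) simp
  then have "poly (S q) 0 \<noteq> 0" "poly (T Q) 0 \<noteq> 0"
    using pq PQ by (auto simp: S T is_quotient_on_ball_def)
  then have "S q \<noteq> 0" "T Q \<noteq> 0" by auto
  obtain u where u: "T Q = u * S q" "\<And>j. T (P $ j) = u * S (p $ j)"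
    using proportional_if_no_common_zero[of "\<lambda>j. S (p $ j)" "T Q" "S q" "\<lambda>j. T (P $ j)"]
      cross \<open>S q \<noteq> 0\<close> coprime S(1) by metis
  have "u \<noteq> 0" using u(1) \<open>T Q \<noteq> 0\<close> by auto
  have "cpoly_degree F * D \<le> degree (S F)" using F(2) S(2)[of F] by (intro le_degree) simp
  also have "S F \<noteq> 0" using F(2) S(2)[of F] by auto
  then have "degree (S F) \<le> degree (u * S F)" using \<open>u \<noteq> 0\<close> by (simp add: degree_mult_eq)
  also have "degree (u * S F) \<le> max (cpoly_map_degree P) (cpoly_degree Q)"
    using F(1)
  proof
    assume "F = q"
    then show ?thesis using u(1) T(2)[of Q] by simp
  next
    assume "\<exists>j. F = p $ j"
    then obtain j where "F = p $ j" ..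
    then show ?thesis using u(2)[of j] T(2)[of "P $ j"] cpoly_degree_le_map_degree[of P j] by simp
  qed
  finally show ?thesis .
qed

theorem theorem2:
  fixes c :: "nat \<Rightarrow> nat \<Rightarrow> real"
  assumes "CARD('n::finite) \<ge> 2" and "CARD('m::finite) \<ge> 2"
    and "\<forall>(f :: complex ^ 2 \<Rightarrow> complex ^ 'm) d.
           rational_proper_ball_map f \<longrightarrow> has_rational_degree f d \<longrightarrow> real d \<le> c 2 CARD('m)"
  shows "\<forall>(f :: complex ^ 'n \<Rightarrow> complex ^ 'm) d.
           rational_proper_ball_map f \<longrightarrow> has_rational_degree f d \<longrightarrow>
           real d \<le> c 2 CARD('m) / (2 * real CARD('n) - 3)"
proof (intro allI impI)
  fix f :: "complex ^ 'n \<Rightarrow> complex ^ 'm" and d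
  assume f: "rational_proper_ball_map f" and "has_rational_degree f d"
  then obtain p q where pq: "is_quotient_on_ball f p q" and low: "lowest_terms p q"
    and d: "d = max (cpoly_map_degree p) (cpoly_degree q)"
    by (auto simp: has_rational_degree_def)
  have q0: "cpoly_eval q 0 \<noteq> 0" using pq by (auto simp: is_quotient_on_ball_def)
  then have "q \<noteq> 0" by auto
  then obtain F where F: "F = q \<or> (\<exists>j. F = p $ j)" "F \<noteq> 0" "cpoly_degree F = d"
    using ex_component_of_degree[of q p] d by metis
  define D where "D = 2 * CARD('n) - 3"
  have "D > 0" using assms(1) by (simp add: D_def)
  obtain \<kappa> :: "'n \<Rightarrow> real" and \<alpha> \<beta> i0 where \<kappa>: "\<And>i. \<kappa> i > 0" and exps: "\<And>i. 1 \<le> \<alpha> i + \<beta> i"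
    "\<And>i. \<alpha> i + \<beta> i \<le> D" "\<alpha> i0 + \<beta> i0 = D"
    and id: "\<And>x y. x + y = 1 \<Longrightarrow> (\<Sum>i\<in>UNIV. (\<kappa> i)\<^sup>2 * x ^ \<alpha> i * y ^ \<beta> i) = 1"
    using ex_monomial_sphere_identity[OF assms(1), folded D_def] by blast
  obtain A :: "complex ^ 'n ^ 'n" and \<zeta> where A: "\<And>x. norm (A *v x) = norm x"
    and \<zeta>: "\<And>i. cmod (\<zeta> i) = \<kappa> i"
    and top: "top_form F (A *v (\<chi> i. coeff (monom (\<zeta> i) (\<alpha> i + \<beta> i)) D)) \<noteq> 0"
    and coprime: "\<And>t. cpoly_eval q (A *v (\<chi> i. \<zeta> i * t ^ (\<alpha> i + \<beta> i))) = 0 \<Longrightarrow>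
       \<exists>j. cpoly_eval (p $ j) (A *v (\<chi> i. \<zeta> i * t ^ (\<alpha> i + \<beta> i))) \<noteq> 0"
    using ex_generic_curve[where k = "\<lambda>i. \<alpha> i + \<beta> i" and D = D and \<kappa> = \<kappa> and ?i0.0 = i0,
      OF low q0 F(2) \<kappa> exps] by blast
  define M where "M = (\<lambda>z :: complex ^ 2. \<chi> i. \<zeta> i * (z $ 1) ^ \<alpha> i * (z $ 2) ^ \<beta> i)"
  define G where "G = (\<lambda>z. A *v M z)"
  have normG: "(norm (G z))\<^sup>2 = (\<Sum>i\<in>UNIV. (\<kappa> i)\<^sup>2 * ((cmod (z $ 1))\<^sup>2) ^ \<alpha> i * ((cmod (z $ 2))\<^sup>2) ^ \<beta> i)" for z
    by (simp add: G_def A norm_vec_square M_def norm_mult norm_power \<zeta> power_mult_distrib)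
      (simp add: mult.commute flip: power_mult)
  have normz: "(norm z)\<^sup>2 = (cmod (z $ 1))\<^sup>2 + (cmod (z $ 2))\<^sup>2" for z :: "complex ^ 2"
    by (simp add: norm_vec_square sum_2)
  have sphere: "norm (G z) = 1" if "norm z = 1" for z
  proof -
    have "(norm (G z))\<^sup>2 = 1" unfolding normG by (rule id) (use normz[of z] that in simp)
    then show ?thesis using norm_ge_zero[of "G z"] by (auto simp: power2_eq_1_iff)
  qed
  have inside: "norm (G z) < 1" if "norm z < 1" for z
  proof -
    have "(norm z)\<^sup>2 < 1" using that by (simp add: power_less_one_iff abs_square_less_1)
    then have "(norm (G z))\<^sup>2 < 1" unfolding normG
      by (intro monomial_sum_less_1 id exps(1)) (simp_all add: normz)
    then show ?thesis by (simp add: abs_square_less_1)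
  qed
  have poly: "polyfun (\<lambda>z. G z $ i)" for i
    unfolding G_def M_def matrix_vector_mult_def
    by (auto intro!: polyfun_sum polyfun_mult polyfun_power)
  have rat: "rational_proper_ball_map (f \<circ> G)"
    using f by (intro rational_proper_compose[OF _ pq poly inside sphere]) (simp_all add: rational_proper_ball_map_def)
  then obtain P Q where PQ: "is_quotient_on_ball (f \<circ> G) P Q" "lowest_terms P Q"
    unfolding rational_proper_ball_map_def using ex_lowest_terms by blast
  define g where "g = (\<lambda>i. \<Sum>l\<in>UNIV. smult (A $ i $ l) (monom (\<zeta> l) (\<alpha> l + \<beta> l)))"
  have diag: "G (t *s (\<chi> _. 1)) = A *v (\<chi> i. \<zeta> i * t ^ (\<alpha> i + \<beta> i))" for t
    by (simp add: G_def M_def power_add mult.assoc)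
  have "cpoly_degree F * D \<le> max (cpoly_map_degree P) (cpoly_degree Q)"
  proof (rule degree_times_le_composite_degree[OF pq PQ(1) inside _ _ \<open>D > 0\<close> _ F(1)])
    show "poly (g i) t = G (t *s (\<chi> _. 1)) $ i" for i t
      by (simp add: g_def diag matrix_vector_mult_def poly_sum poly_monom)
    show "degree (g i) \<le> D" for i
      unfolding g_def
      by (intro degree_sum_le) (auto intro: order.trans[OF degree_smult_le] order.trans[OF degree_monom_le] exps(2))
    have "(\<chi> i. coeff (g i) D) = A *v (\<chi> i. coeff (monom (\<zeta> i) (\<alpha> i + \<beta> i)) D)"
      by (simp add: g_def matrix_vector_mult_def coeff_sum vec_eq_iff)
    then show "top_form F (\<chi> i. coeff (g i) D) \<noteq> 0" using top by simp
    show "\<exists>j. cpoly_eval (p $ j) (G (t *s (\<chi> _. 1))) \<noteq> 0" if "cpoly_eval q (G (t *s (\<chi> _. 1))) = 0" for t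
      using coprime[of t] that by (simp add: diag)
  qed
  moreover have "has_rational_degree (f \<circ> G) (max (cpoly_map_degree P) (cpoly_degree Q))"
    using PQ by (auto simp: has_rational_degree_def)
  then have "real (max (cpoly_map_degree P) (cpoly_degree Q)) \<le> c 2 CARD('m)"
    using assms(3) rat by blast
  ultimately have "real (d * D) \<le> c 2 CARD('m)" using F(3) by (metis of_nat_mono order_trans)
  moreover have "real D = 2 * real CARD('n) - 3" using assms(1) by (simp add: D_def of_nat_diff)
  ultimately show "real d \<le> c 2 CARD('m) / (2 * real CARD('n) - 3)"
    using \<open>D > 0\<close> by (metis of_nat_0_less_iff of_nat_mult pos_le_divide_eq)
qed

end
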